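(* Let $\mathcal F=\{f_1,\dots,f_k\}$ be a defining family of convenient non-degenerate complete intersection varieties in a neighborhood of the origin of $\mathbb C^n$ (with $f_\alpha(\mathbf 0)=0$ for all $\alpha$), and let $f=f_1\cdots f_k$ be the associated product function. For $1\le\alpha\le k$, $1\le j\le n$ let $z_j^{b_{\alpha,j}}$ be the monomial corresponding to the unique point of $\Gamma(f_\alpha)$ on the $z_j$-axis, and put $B_j=\sum_{\alpha=1}^k b_{\alpha,j}$ and $B=\max\{B_1,\dots,B_n\}$. Then $$\theta_0(f)\le 1-\frac1B,$$ and the equality holds if $f$ has a non-exceptional Łojasiewicz monomial.
   Context: Łojasiewicz exponent: $\partial f=(\partial f/\partial z_1,\dots,\partial f/\partial z_n)$, and $\theta_0(f)$ is the infimum of all $\theta\in[0,1)$ for which there exist $c>0$ and a neighborhood $U$ of $\mathbf 0$ with $\|\partial f(\mathbf z)\|\ge c|f(\mathbf z)|^\theta$ for all $\mathbf z\in U$. For an analytic function $h(\mathbf z)=\sum_\nu c_\nu\mathbf z^\nu$, $\Gamma_+(h)$ is the convex hull of $\bigcup_{c_\nu\ne0}(\nu+\mathbb R_+^n)$, and the Newton boundary $\Gamma(h)$ is the union of compact faces of $\Gamma_+(h)$. For a strictly positive weight vector $P=(p_1,\dots,p_n)$ (all $p_i>0$), $\Delta(P,h)$ is the face of $\Gamma_+(h)$ where $\nu\mapsto\sum_i p_i\nu_i$ is minimal and $h_P(\mathbf z)=\sum_{\nu\in\Delta(P,h)}c_\nu\mathbf z^\nu$. $h$ is non-degenerate if $h_P:\mathbb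 C^{*n}\to\mathbb C$ has no critical point for every strictly positive $P$, where $\mathbb C^{*n}=\{\mathbf z\mid z_i\ne0\ \forall i\}$. $h$ is convenient if $\Gamma(h)$ meets each coordinate axis. $\mathcal F=\{f_1,\dots,f_k\}$ is a defining family of convenient non-degenerate complete intersection varieties if each $f_\alpha$ is a convenient non-degenerate function and, for each $I\subset\{1,\dots,k\}$, $V(I)=\{f_i=0,\ i\in I\}$ is a non-degenerate complete intersection variety, i.e. for every strictly positive weight vector $P$ the variety $V_I(P)^*=\{\mathbf z\in\mathbb C^{*n}\mid f_{jP}(\mathbf z)=0,\ j\in I\}$ is a smooth complete intersection in $\mathbb C^{*n}$ (the gradients $\partial f_{jP}$, $j\in I$, are linearly independent at every point of $V_I(P)^*$; the variety may be empty). Here $f_{jP}$ denotes the face function $(f_j)_P$. The point of $\Gamma(f)$ on the $z_j$-axis corresponds to $z_j^{B_j}$. This monomial is called a Łojasiewicz monomial of $f$ if $B_j=B$. It is exceptional if moreover there exist $i\neq j$ and a monomial $z_j^{B'}z_i$ appearing in $f(\mathbf z)$ (with non-zero coefficient) with $B'<B-1$. Otherwise a Łojasiewicz monomial is called non-exceptional. *)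

theory Defs
  imports "HOL-Analysis.Analysis"
begin

definition monom_val :: "complex^'n \<Rightarrow> nat^'n \<Rightarrow> complex" where
  "monom_val z \<nu> = (\<Prod>i\<in>UNIV. (z $ i) ^ (\<nu> $ i))"

definition has_power_series_0 ::
    "(complex^'n \<Rightarrow> complex) \<Rightarrow> (nat^'n \<Rightarrow> complex) \<Rightarrow> bool" where
  "has_power_series_0 h c \<longleftrightarrow>
     (\<exists>r>0. \<forall>z. (\<forall>i. cmod (z $ i) < r) \<longrightarrow> ((\<lambda>\<nu>. c \<nu> * monom_val z \<nu>) has_sum h z) UNIV)"

definition analytic_at_0 :: "(complex^'n \<Rightarrow> complex) \<Rightarrow> bool" where
  "analytic_at_0 h \<longleftrightarrow> (\<exists>c. has_power_series_0 h c)"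

text \<open>The coefficients of a convergent power series are determined by its sum near the origin, so
  the description below is proper whenever \<open>h\<close> is analytic at the origin.\<close>

definition taylor_coeff :: "(complex^'n \<Rightarrow> complex) \<Rightarrow> nat^'n \<Rightarrow> complex" where
  "taylor_coeff h = (THE c. has_power_series_0 h c)"

definition cgrad :: "(complex^'n \<Rightarrow> complex) \<Rightarrow> complex^'n \<Rightarrow> complex^'n" where
  "cgrad h z = (\<chi> i. deriv (\<lambda>w. h (\<chi> l. if l = i then w else z $ l)) (z $ i))"

text \<open>The exponent \<open>\<theta> = 0\<close> is treated separately because \<open>0 powr 0 = 0\<close> in HOL, whereas
  \<open>\<bar>f z\<bar>\<close> to the power zero means \<open>1\<close>. The infimum is taken in \<^typ>\<open>ereal\<close>, so that it would be
  \<open>\<infinity>\<close> (and not an unspecified real) if there were no admissible exponent.\<close>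

definition lojasiewicz_admissible :: "(complex^'n \<Rightarrow> complex) \<Rightarrow> real \<Rightarrow> bool" where
  "lojasiewicz_admissible f \<theta> \<longleftrightarrow> 0 \<le> \<theta> \<and> \<theta> < 1 \<and>
     (\<exists>c>0. \<exists>U. open U \<and> 0 \<in> U \<and>
       (\<forall>z\<in>U. norm (cgrad f z) \<ge> c * (if \<theta> = 0 then 1 else cmod (f z) powr \<theta>)))"

definition lojasiewicz_exponent :: "(complex^'n \<Rightarrow> complex) \<Rightarrow> ereal" where
  "lojasiewicz_exponent f = (INF \<theta>\<in>{\<theta>. lojasiewicz_admissible f \<theta>}. ereal \<theta>)"

definition exponent_point :: "nat^'n \<Rightarrow> real^'n" where
  "exponent_point \<nu> = (\<chi> i. real (\<nu> $ i))"

definition newton_polyhedron :: "(complex^'n \<Rightarrow> complex) \<Rightarrow> (real^'n) set" where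
  "newton_polyhedron h =
     convex hull (\<Union>\<nu>\<in>{\<nu>. taylor_coeff h \<nu> \<noteq> 0}. {exponent_point \<nu> + x | x. \<forall>i. 0 \<le> x $ i})"

definition newton_boundary :: "(complex^'n \<Rightarrow> complex) \<Rightarrow> (real^'n) set" where
  "newton_boundary h = \<Union>{F. F face_of newton_polyhedron h \<and> compact F}"

definition strictly_positive :: "real^'n \<Rightarrow> bool" where
  "strictly_positive P \<longleftrightarrow> (\<forall>i. 0 < P $ i)"

definition weight_face :: "real^'n \<Rightarrow> (complex^'n \<Rightarrow> complex) \<Rightarrow> (real^'n) set" where
  "weight_face P h = {x \<in> newton_polyhedron h. \<forall>y \<in> newton_polyhedron h. P \<bullet> x \<le> P \<bullet> y}"

text \<open>For strictly positive \<open>P\<close> the index set of this sum is finite.\<close>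

definition face_function ::
    "real^'n \<Rightarrow> (complex^'n \<Rightarrow> complex) \<Rightarrow> complex^'n \<Rightarrow> complex" where
  "face_function P h z =
     (\<Sum>\<nu> | exponent_point \<nu> \<in> weight_face P h. taylor_coeff h \<nu> * monom_val z \<nu>)"

definition complex_torus :: "(complex^'n) set" where
  "complex_torus = {z. \<forall>i. z $ i \<noteq> 0}"

definition nondegenerate :: "(complex^'n \<Rightarrow> complex) \<Rightarrow> bool" where
  "nondegenerate h \<longleftrightarrow>
     (\<forall>P. strictly_positive P \<longrightarrow> (\<forall>z\<in>complex_torus. cgrad (face_function P h) z \<noteq> 0))"

definition convenient :: "(complex^'n \<Rightarrow> complex) \<Rightarrow> bool" where
  "convenient h \<longleftrightarrow> (\<forall>j. \<exists>x \<in> newton_boundary h. \<forall>i. i \<noteq> j \<longrightarrow> x $ i = 0)"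

text \<open>Linear independence is that of the family indexed by \<open>I\<close>, not of the set of gradients:
  coinciding gradients are dependent.\<close>

definition nondegenerate_complete_intersection ::
    "('a \<Rightarrow> complex^'n \<Rightarrow> complex) \<Rightarrow> 'a set \<Rightarrow> bool" where
  "nondegenerate_complete_intersection f I \<longleftrightarrow>
     (\<forall>P. strictly_positive P \<longrightarrow>
       (\<forall>z\<in>complex_torus. (\<forall>j\<in>I. face_function P (f j) z = 0) \<longrightarrow>
         (\<forall>a. (\<Sum>j\<in>I. a j *s cgrad (face_function P (f j)) z) = 0 \<longrightarrow> (\<forall>j\<in>I. a j = 0))))"

definition defining_family :: "nat \<Rightarrow> (nat \<Rightarrow> complex^'n \<Rightarrow> complex) \<Rightarrow> bool" where
  "defining_family k f \<longleftrightarrow>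
     (\<forall>\<alpha>\<in>{1..k}. analytic_at_0 (f \<alpha>) \<and> convenient (f \<alpha>) \<and> nondegenerate (f \<alpha>)) \<and>
     (\<forall>I. I \<subseteq> {1..k} \<longrightarrow> nondegenerate_complete_intersection f I)"

text \<open>For convenient \<open>h\<close> the Newton boundary meets the \<open>j\<close>-th axis in exactly one point, and that
  point is integral.\<close>

definition axis_exponent :: "(complex^'n \<Rightarrow> complex) \<Rightarrow> 'n \<Rightarrow> nat" where
  "axis_exponent h j = (THE b. axis j (real b) \<in> newton_boundary h)"

definition max_axis_exponent :: "(complex^'n \<Rightarrow> complex) \<Rightarrow> nat" where
  "max_axis_exponent h = Max (range (axis_exponent h))"

text \<open>A monomial on the \<open>j\<close>-th axis is referred to by its index \<open>j\<close>.\<close>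

definition lojasiewicz_monomial :: "(complex^'n \<Rightarrow> complex) \<Rightarrow> 'n \<Rightarrow> bool" where
  "lojasiewicz_monomial f j \<longleftrightarrow> axis_exponent f j = max_axis_exponent f"

text \<open>The condition \<open>B' < B - 1\<close> is written without truncated subtraction; the multi-index
  \<open>axis j B' + axis i 1\<close> is that of the monomial with \<open>j\<close>-th exponent \<open>B'\<close> and \<open>i\<close>-th
  exponent \<open>1\<close>.\<close>

definition exceptional_monomial :: "(complex^'n \<Rightarrow> complex) \<Rightarrow> 'n \<Rightarrow> bool" where
  "exceptional_monomial f j \<longleftrightarrow> lojasiewicz_monomial f j \<and>
     (\<exists>i B'. i \<noteq> j \<and> taylor_coeff f (axis j B' + axis i 1) \<noteq> 0 \<and> B' + 1 < max_axis_exponent f)"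

end

theory Submission
  imports Defs "HOL-Complex_Analysis.Cauchy_Integral_Formula"
begin

text \<open>
  The upper bound rests on one estimate for the logarithmic gradient. Let \<open>A \<alpha>\<close> be the finite set of
  exponents of \<open>f\<^sub>\<alpha>\<close> lying in the box spanned by its axis exponents, and let
  \<open>M\<^sub>\<alpha>(z)\<close> be the sum of \<open>\<bar>z\<^sup>\<nu>\<bar>\<close> over \<open>A \<alpha>\<close>. Convenience puts every other exponent strictly above
  a pure power, so \<open>M\<^sub>\<alpha>\<close> controls the whole series. Write \<open>u\<^sub>\<alpha> = f\<^sub>\<alpha> / M\<^sub>\<alpha>\<close> and
  \<open>e\<^sub>\<alpha>\<^sub>i = z\<^sub>i \<partial>\<^sub>i f\<^sub>\<alpha> / M\<^sub>\<alpha>\<close> (\<open>scaled_value\<close> and \<open>scaled_euler\<close> below); both stay bounded near the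
  origin. By the product rule

    \<open>z\<^sub>i \<partial>\<^sub>i f = (\<Prod>\<alpha>. M\<^sub>\<alpha>) * (\<Sum>\<alpha>. \<lambda>\<^sub>\<alpha> e\<^sub>\<alpha>\<^sub>i)\<close> with \<open>\<lambda>\<^sub>\<alpha> = (\<Prod>\<beta>\<noteq>\<alpha>. u\<^sub>\<beta>)\<close> (\<open>cofactor_product\<close>).

  The key inequality (\<open>toric_gradient_inequality\<close>) says that at torus points near the origin
  \<open>\<Sum>i. \<bar>\<Sum>\<alpha>. \<lambda>\<^sub>\<alpha> e\<^sub>\<alpha>\<^sub>i\<bar> \<ge> c * (\<Sum>\<alpha>. \<bar>\<lambda>\<^sub>\<alpha>\<bar>)\<close>. Suppose it fails along a sequence tending to \<open>0\<close>. After
  passing to a subsequence all ratios \<open>z\<^sup>\<nu> / M\<^sub>\<alpha>\<close> converge, and \<open>monomial_limits_on_face\<close> produces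
  a strictly positive weight \<open>P\<close> and a torus point \<open>w\<close> such that the surviving monomials of each
  \<open>f\<^sub>\<alpha>\<close> are exactly those of its face function for \<open>P\<close>, with limits proportional to \<open>w\<^sup>\<nu>\<close>. In the
  limit one obtains coefficients \<open>l\<^sub>\<alpha>\<close>, not all zero, with \<open>\<Sum>\<alpha>. l\<^sub>\<alpha> \<kappa>\<^sub>\<alpha> w\<^sub>i \<partial>\<^sub>i f\<^sub>\<alpha>\<^sub>P(w) = 0\<close> for all
  \<open>i\<close> and with \<open>l\<^sub>\<alpha> \<kappa>\<^sub>\<alpha> f\<^sub>\<alpha>\<^sub>P(w) = s\<close> independent of \<open>\<alpha>\<close>. Euler's relation for the weighted
  homogeneous \<open>f\<^sub>\<alpha>\<^sub>P\<close> forces \<open>s = 0\<close>; then \<open>l\<close> is supported where \<open>f\<^sub>\<alpha>\<^sub>P(w) = 0\<close>, contradicting the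
  linear independence of the gradients there (\<open>face_system_only_trivial_solution\<close>).
  This limiting argument plays the part of the curve selection lemma.

  Since \<open>\<Prod>\<alpha>. M\<^sub>\<alpha>\<close> contains the monomials \<open>z\<^sub>j\<close> to the power \<open>B\<^sub>j\<close>, it is at least a multiple of
  \<open>\<parallel>z\<parallel>\<close> to the power \<open>B\<close>. Together with \<open>\<bar>f\<bar> = (\<Prod>\<alpha>. \<bar>u\<^sub>\<alpha>\<bar>) * (\<Prod>\<alpha>. M\<^sub>\<alpha>)\<close> and elementary
  estimates of \<open>\<lambda>\<close> by \<open>u\<close> this gives \<open>\<parallel>\<partial>f\<parallel>\<^sup>B \<ge> K * \<bar>f\<bar>\<^sup>B\<^sup>-\<^sup>1\<close> on the torus, and then in a full
  neighbourhood by continuity (\<open>gradient_inequality\<close>). Taking \<open>B\<close>-th roots gives admissibility of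
  \<open>1 - 1/B\<close>.

  For sharpness, restrict to the axis of a non-exceptional monomial. The order of vanishing of
  \<open>f\<close> along an axis is additive in products, so it is \<open>B\<close> there; non-exceptionality
  says that every partial derivative vanishes to order at least \<open>B - 1\<close> along that axis. Comparing
  powers of the axis parameter excludes all \<open>\<theta> < 1 - 1/B\<close> (\<open>lojasiewicz_admissible_lower_bound\<close>).
\<close>

section \<open>Convergent power series in several variables\<close>

definition polydisc :: "real \<Rightarrow> (complex^'n) set" where
  "polydisc r = {z. \<forall>i. cmod (z $ i) < r}"

definition total_degree :: "nat^'n \<Rightarrow> nat" where
  "total_degree \<nu> = (\<Sum>i\<in>UNIV. \<nu> $ i)"

definition power_series_on ::
    "real \<Rightarrow> (complex^'n \<Rightarrow> complex) \<Rightarrow> (nat^'n \<Rightarrow> complex) \<Rightarrow> bool" where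
  "power_series_on r h c \<longleftrightarrow>
     0 < r \<and> (\<forall>z\<in>polydisc r. ((\<lambda>\<nu>. c \<nu> * monom_val z \<nu>) has_sum h z) UNIV)"

lemma has_power_series_0_iff: "has_power_series_0 h c \<longleftrightarrow> (\<exists>r. power_series_on r h c)"
  by (auto simp: has_power_series_0_def power_series_on_def polydisc_def)

lemma open_polydisc: "open (polydisc r :: (complex^'n) set)"
proof -
  have "polydisc r = (\<Inter>i\<in>UNIV. {z::complex^'n. cmod (z $ i) < r})"
    by (auto simp: polydisc_def)
  moreover have "open {z::complex^'n. cmod (z $ i) < r}" for i
    by (intro open_Collect_less continuous_intros)
  ultimately show ?thesis by (simp add: open_INT)
qed

lemma polydisc_mono: "r \<le> s \<Longrightarrow> polydisc r \<subseteq> polydisc s"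
  unfolding polydisc_def by (auto intro: less_le_trans)

lemma zero_in_polydisc: "0 < r \<Longrightarrow> 0 \<in> polydisc r"
  by (simp add: polydisc_def)

lemma polydisc_shrink:
  fixes z :: "complex^'n"
  assumes "z \<in> polydisc r"
  obtains \<rho> where "0 < \<rho>" "\<rho> < r" "z \<in> polydisc \<rho>"
proof -
  let ?M = "Max (range (\<lambda>i. cmod (z $ i)))"
  have "?M < r" using assms by (auto simp: polydisc_def)
  moreover have "0 \<le> ?M"
    by (rule order_trans[of _ "cmod (z $ undefined)"]) (auto intro!: Max_ge)
  moreover from calculation have "0 < r" by linarith
  ultimately have "0 < (?M + r) / 2" "(?M + r) / 2 < r" "?M < (?M + r) / 2" by auto
  moreover from this(3) have "z \<in> polydisc ((?M + r) / 2)"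
  proof -
    have "cmod (z $ i) \<le> ?M" for i by (rule Max_ge) auto
    then show ?thesis using \<open>?M < (?M + r) / 2\<close> unfolding polydisc_def mem_Collect_eq by (meson le_less_trans)
  qed
  ultimately show ?thesis using that by blast
qed

lemma power_series_on_mono: "power_series_on r h c \<Longrightarrow> 0 < s \<Longrightarrow> s \<le> r \<Longrightarrow> power_series_on s h c"
  using polydisc_mono[of s r] unfolding power_series_on_def by blast

lemma power_series_on_diff:
  "power_series_on r h c \<Longrightarrow> power_series_on r g d \<Longrightarrow>
   power_series_on r (\<lambda>z. h z - g z) (\<lambda>\<nu>. c \<nu> - d \<nu>)"
  using has_sum_add[OF _ has_sum_uminusI]
  by (fastforce simp: power_series_on_def ring_distribs)

lemma power_series_on_const: "0 < r \<Longrightarrow> power_series_on r (\<lambda>z. a) (\<lambda>\<nu>. if \<nu> = 0 then a else 0)"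
  unfolding power_series_on_def
proof safe
  fix z :: "complex^'n"
  have "((\<lambda>\<nu>. (if \<nu> = 0 then a else 0) * monom_val z \<nu>) has_sum
         (\<Sum>\<nu>\<in>{0}. (if \<nu> = 0 then a else 0) * monom_val z \<nu>)) {0}"
    by (rule has_sum_finite) simp
  then show "((\<lambda>\<nu>. (if \<nu> = 0 then a else 0) * monom_val z \<nu>) has_sum a) UNIV"
    by (subst has_sum_cong_neutral[where S = UNIV and T = "{0}"]) (auto simp: monom_val_def)
qed

lemma power_series_on_polynomial:
  fixes c :: "nat^'n \<Rightarrow> complex"
  assumes "finite A" "0 < r" "\<And>\<nu>. \<nu> \<notin> A \<Longrightarrow> c \<nu> = 0"
  shows "power_series_on r (\<lambda>z. \<Sum>\<nu>\<in>A. c \<nu> * monom_val z \<nu>) c"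
  unfolding power_series_on_def
proof safe
  fix z :: "complex^'n"
  have "((\<lambda>\<nu>. c \<nu> * monom_val z \<nu>) has_sum (\<Sum>\<nu>\<in>A. c \<nu> * monom_val z \<nu>)) A"
    by (rule has_sum_finite) fact
  then show "((\<lambda>\<nu>. c \<nu> * monom_val z \<nu>) has_sum (\<Sum>\<nu>\<in>A. c \<nu> * monom_val z \<nu>)) UNIV"
    by (subst has_sum_cong_neutral[where S = UNIV and T = A]) (use assms in auto)
qed fact

lemma monom_val_0 [simp]: "monom_val z 0 = 1"
  by (simp add: monom_val_def)

lemma monom_val_add: "monom_val z (\<mu> + \<nu>) = monom_val z \<mu> * monom_val z \<nu>"
  by (simp add: monom_val_def power_add prod.distrib)

lemma monom_val_at_0: "monom_val 0 \<nu> = (if \<nu> = 0 then 1 else 0)"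
  by (auto simp: monom_val_def vec_eq_iff)

lemma monom_val_axis: "monom_val z (axis j m) = (z $ j) ^ m"
proof -
  have "monom_val z (axis j m) = (\<Prod>i\<in>UNIV. if i = j then (z $ j) ^ m else 1)"
    unfolding monom_val_def by (rule prod.cong) (auto simp: axis_def)
  then show ?thesis by simp
qed

lemma monom_val_nonzero: "z \<in> complex_torus \<Longrightarrow> monom_val z \<nu> \<noteq> 0"
  by (simp add: monom_val_def complex_torus_def)

lemma norm_monom_val: "norm (monom_val z \<nu>) = (\<Prod>i\<in>UNIV. norm (z $ i) ^ (\<nu> $ i))"
  by (simp add: monom_val_def norm_power prod_norm[symmetric])

lemma norm_monom_val_le:
  assumes "\<And>i. norm (z $ i) \<le> \<rho>"
  shows "norm (monom_val z \<nu>) \<le> \<rho> ^ total_degree \<nu>"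
  unfolding norm_monom_val total_degree_def power_sum
  by (intro prod_mono) (auto intro!: power_mono assms)

lemma continuous_on_monom_val: "continuous_on S (\<lambda>z. monom_val z \<nu>)"
  unfolding monom_val_def by (intro continuous_intros)

lemma monom_val_split:
  "monom_val (\<chi> l. if l = i then w else z $ l) \<nu> =
   w ^ (\<nu> $ i) * (\<Prod>l\<in>UNIV - {i}. (z $ l) ^ (\<nu> $ l))"
proof -
  have "monom_val (\<chi> l. if l = i then w else z $ l) \<nu> =
     w ^ (\<nu> $ i) * (\<Prod>l\<in>UNIV - {i}. ((\<chi> l. if l = i then w else z $ l) $ l) ^ (\<nu> $ l))"
    unfolding monom_val_def by (subst prod.remove[of _ i]) auto
  also have "(\<Prod>l\<in>UNIV - {i}. ((\<chi> l. if l = i then w else z $ l) $ l) ^ (\<nu> $ l)) =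
     (\<Prod>l\<in>UNIV - {i}. (z $ l) ^ (\<nu> $ l))"
    by (rule prod.cong) auto
  finally show ?thesis .
qed

lemma power_series_summable:
  assumes "power_series_on r h c" "0 \<le> \<rho>" "\<rho> < r"
  shows "(\<lambda>\<nu>. norm (c \<nu>) * \<rho> ^ total_degree \<nu>) summable_on UNIV"
proof -
  let ?z = "(\<chi> i. complex_of_real \<rho>) :: complex^'a"
  have "?z \<in> polydisc r" using assms by (simp add: polydisc_def)
  then have "(\<lambda>\<nu>. c \<nu> * monom_val ?z \<nu>) summable_on UNIV"
    using assms by (auto simp: power_series_on_def summable_on_def)
  then have "(\<lambda>\<nu>. norm (c \<nu> * monom_val ?z \<nu>)) summable_on UNIV"
    by (simp add: summable_on_iff_abs_summable_on_complex)
  moreover have "norm (c \<nu> * monom_val ?z \<nu>) = norm (c \<nu>) * \<rho> ^ total_degree \<nu>" for \<nu>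
    using assms by (simp add: norm_mult norm_monom_val total_degree_def power_sum)
  ultimately show ?thesis by simp
qed

lemma power_series_uniform_limit:
  assumes "power_series_on r h c" "0 \<le> \<rho>" "\<rho> < r" "\<And>z i. z \<in> K \<Longrightarrow> norm (z $ i) \<le> \<rho>"
  shows "uniform_limit K (\<lambda>X z. \<Sum>\<nu>\<in>X. c \<nu> * monom_val z \<nu>) h (finite_subsets_at_top UNIV)"
proof (rule Weierstrass_m_test_general')
  show "norm (c \<nu> * monom_val z \<nu>) \<le> norm (c \<nu>) * \<rho> ^ total_degree \<nu>" if "z \<in> K" for \<nu> z
    using norm_monom_val_le[OF assms(4)[OF that]] by (simp add: norm_mult mult_left_mono)
  show "((\<lambda>\<nu>. c \<nu> * monom_val z \<nu>) has_sum h z) UNIV" if "z \<in> K" for z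
  proof -
    have "z \<in> polydisc r" using assms(3) assms(4)[OF that] by (auto simp: polydisc_def intro: le_less_trans)
    then show ?thesis using assms(1) by (simp add: power_series_on_def)
  qed
qed (rule power_series_summable[OF assms(1-3)])

lemma power_series_continuous:
  assumes "power_series_on r h c"
  shows "continuous_on (polydisc r) h"
proof -
  have "isCont h z" if z: "z \<in> polydisc r" for z
  proof -
    obtain \<rho> where \<rho>: "0 < \<rho>" "\<rho> < r" "z \<in> polydisc \<rho>" using polydisc_shrink[OF z] .
    have "uniform_limit (polydisc \<rho>) (\<lambda>X z. \<Sum>\<nu>\<in>X. c \<nu> * monom_val z \<nu>) h (finite_subsets_at_top UNIV)"
      by (rule power_series_uniform_limit[OF assms, of \<rho>]) (use \<rho> in \<open>auto simp: polydisc_def less_imp_le\<close>)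
    then have "continuous_on (polydisc \<rho>) h"
      by (rule uniform_limit_theorem[rotated])
         (auto intro!: always_eventually continuous_intros continuous_on_monom_val)
    then show ?thesis using \<rho> open_polydisc continuous_on_eq_continuous_at by blast
  qed
  then show ?thesis by (simp add: continuous_at_imp_continuous_on)
qed

text \<open>The finite partial sums are polynomials converging uniformly on compact polydiscs, so in each
  variable separately Weierstrass' theorem on uniform limits of holomorphic functions applies. Taking
  the limit along all finite sets of multi-indices yields the unordered sum of the differentiated
  terms at once.\<close>

lemma power_series_partial_derivative:
  fixes h :: "complex^'n \<Rightarrow> complex"
  assumes h: "power_series_on r h c" and z: "z \<in> polydisc r"
  shows "((\<lambda>w. h (\<chi> l. if l = i then w else z $ l)) has_field_derivative cgrad h z $ i) (at (z $ i))"
    and "((\<lambda>\<nu>. c \<nu> * (of_nat (\<nu> $ i) * (z $ i) ^ (\<nu> $ i - 1) *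
             (\<Prod>l\<in>UNIV - {i}. (z $ l) ^ (\<nu> $ l)))) has_sum cgrad h z $ i) UNIV"
proof -
  obtain \<rho> where \<rho>: "0 < \<rho>" "\<rho> < r" "z \<in> polydisc \<rho>" using polydisc_shrink[OF z] .
  define s where "s = \<rho> - norm (z $ i)"
  have s: "s > 0" using \<rho> by (simp add: s_def polydisc_def)
  let ?p = "\<lambda>w. (\<chi> l. if l = i then w else z $ l) :: complex^'n"
  let ?Q = "\<lambda>\<nu>. (\<Prod>l\<in>UNIV - {i}. (z $ l) ^ (\<nu> $ l))"
  have small: "norm (?p w $ l) \<le> \<rho>" if "w \<in> cball (z $ i) s" for w l
    using that \<rho> norm_triangle_ineq2[of w "z $ i"]
    by (auto simp: s_def polydisc_def dist_norm norm_minus_commute less_imp_le)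
  have "uniform_limit (?p ` cball (z $ i) s) (\<lambda>X z. \<Sum>\<nu>\<in>X. c \<nu> * monom_val z \<nu>) h (finite_subsets_at_top UNIV)"
    by (rule power_series_uniform_limit[OF h, of \<rho>]) (use \<rho> small in \<open>auto simp: less_imp_le\<close>)
  then have "uniform_limit (cball (z $ i) s) (\<lambda>X w. \<Sum>\<nu>\<in>X. c \<nu> * (w ^ (\<nu> $ i) * ?Q \<nu>)) (\<lambda>w. h (?p w))
               (finite_subsets_at_top UNIV)"
    by (simp add: uniform_limit_iff monom_val_split)
  moreover have "((\<lambda>w. \<Sum>\<nu>\<in>X. c \<nu> * (w ^ (\<nu> $ i) * ?Q \<nu>)) has_field_derivative
       (\<Sum>\<nu>\<in>X. c \<nu> * (of_nat (\<nu> $ i) * w ^ (\<nu> $ i - 1) * ?Q \<nu>))) (at w)" for X :: "(nat^'n) set" and w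
    by (auto intro!: derivative_eq_intros sum.cong)
  ultimately obtain g' where g': "\<And>w. w \<in> ball (z $ i) s \<Longrightarrow>
      ((\<lambda>w. h (?p w)) has_field_derivative g' w) (at w) \<and>
      ((\<lambda>X. \<Sum>\<nu>\<in>X. c \<nu> * (of_nat (\<nu> $ i) * w ^ (\<nu> $ i - 1) * ?Q \<nu>)) \<longlongrightarrow> g' w) (finite_subsets_at_top UNIV)"
    using has_complex_derivative_uniform_limit[of "z $ i" s
        "\<lambda>X w. \<Sum>\<nu>\<in>X. c \<nu> * (w ^ (\<nu> $ i) * ?Q \<nu>)"
        "\<lambda>X w. \<Sum>\<nu>\<in>X. c \<nu> * (of_nat (\<nu> $ i) * w ^ (\<nu> $ i - 1) * ?Q \<nu>)"
        "finite_subsets_at_top UNIV" "\<lambda>w. h (?p w)"] s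
    by (force intro!: always_eventually continuous_intros)
  have "g' (z $ i) = cgrad h z $ i"
    unfolding cgrad_def using g'[of "z $ i"] s by (auto intro!: DERIV_imp_deriv[symmetric])
  then show "((\<lambda>w. h (?p w)) has_field_derivative cgrad h z $ i) (at (z $ i))"
    and "((\<lambda>\<nu>. c \<nu> * (of_nat (\<nu> $ i) * (z $ i) ^ (\<nu> $ i - 1) * ?Q \<nu>)) has_sum cgrad h z $ i) UNIV"
    using g'[of "z $ i"] s by (auto simp: has_sum_def)
qed

text \<open>Reindexing by \<open>\<nu> \<mapsto> \<nu> + e\<^sub>i\<close> keeps the differentiated series a power series on the same polydisc,
  which allows induction on the degree in the uniqueness proof and gives continuity of the gradient.\<close>

lemma power_series_gradient:
  fixes h :: "complex^'n \<Rightarrow> complex"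
  assumes h: "power_series_on r h c"
  shows "power_series_on r (\<lambda>z. cgrad h z $ i) (\<lambda>\<nu>. of_nat (\<nu> $ i + 1) * c (\<nu> + axis i 1))"
  unfolding power_series_on_def
proof safe
  fix z :: "complex^'n" assume z: "z \<in> polydisc r"
  let ?Q = "\<lambda>\<nu>. (\<Prod>l\<in>UNIV - {i}. (z $ l) ^ (\<nu> $ l))"
  let ?t = "\<lambda>\<nu>. c \<nu> * (of_nat (\<nu> $ i) * (z $ i) ^ (\<nu> $ i - 1) * ?Q \<nu>)"
  let ?s = "\<lambda>\<nu>::nat^'n. \<nu> + axis i 1"
  have "range ?s = {\<nu>. \<nu> $ i \<noteq> 0}"
  proof safe
    fix \<nu> :: "nat^'n" assume "0 < \<nu> $ i"
    then have "\<nu> = ?s (\<nu> - axis i 1)" by (auto simp: vec_eq_iff axis_def)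
    then show "\<nu> \<in> range ?s" by blast
  qed (auto simp: axis_def)
  then have "(?t has_sum cgrad h z $ i) (range ?s)"
    using power_series_partial_derivative(2)[OF h z, of i]
    by (subst has_sum_cong_neutral[where S = "range ?s" and T = UNIV]) auto
  then have "((?t \<circ> ?s) has_sum cgrad h z $ i) UNIV"
    by (subst (asm) has_sum_reindex) (auto simp: inj_on_def)
  moreover have "?t \<circ> ?s = (\<lambda>\<nu>. of_nat (\<nu> $ i + 1) * c (\<nu> + axis i 1) * monom_val z \<nu>)"
  proof
    fix \<nu>
    have "?Q (?s \<nu>) = ?Q \<nu>" by (rule prod.cong) (auto simp: axis_def)
    moreover have "monom_val z \<nu> = (z $ i) ^ (\<nu> $ i) * ?Q \<nu>"
      unfolding monom_val_def by (subst prod.remove[of _ i]) auto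
    ultimately show "(?t \<circ> ?s) \<nu> = of_nat (\<nu> $ i + 1) * c (\<nu> + axis i 1) * monom_val z \<nu>"
      by (simp add: algebra_simps)
  qed
  ultimately show "((\<lambda>\<nu>. of_nat (\<nu> $ i + 1) * c (\<nu> + axis i 1) * monom_val z \<nu>) has_sum cgrad h z $ i) UNIV"
    by simp
qed (use h in \<open>simp add: power_series_on_def\<close>)

text \<open>The operator \<open>z\<^sub>i \<partial>\<^sub>i\<close> is diagonal on monomials. In contrast to \<open>\<partial>\<^sub>i\<close> it does not move
  exponents, so that one dominating set of monomials serves \<open>h\<close> and its image.\<close>

lemma power_series_euler_operator:
  fixes h :: "complex^'n \<Rightarrow> complex"
  assumes h: "power_series_on r h c"
  shows "power_series_on r (\<lambda>z. z $ i * cgrad h z $ i) (\<lambda>\<nu>. of_nat (\<nu> $ i) * c \<nu>)"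
  unfolding power_series_on_def
proof safe
  fix z :: "complex^'n" assume z: "z \<in> polydisc r"
  have *: "z $ i * (c \<nu> * (of_nat (\<nu> $ i) * (z $ i) ^ (\<nu> $ i - 1) * (\<Prod>l\<in>UNIV - {i}. (z $ l) ^ (\<nu> $ l)))) =
        of_nat (\<nu> $ i) * c \<nu> * monom_val z \<nu>" for \<nu>
  proof -
    have "monom_val z \<nu> = (z $ i) ^ (\<nu> $ i) * (\<Prod>l\<in>UNIV - {i}. (z $ l) ^ (\<nu> $ l))"
      unfolding monom_val_def by (subst prod.remove[of _ i]) auto
    then show ?thesis by (cases "\<nu> $ i") auto
  qed
  show "((\<lambda>\<nu>. of_nat (\<nu> $ i) * c \<nu> * monom_val z \<nu>) has_sum z $ i * cgrad h z $ i) UNIV"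
    using has_sum_cmult_right[OF power_series_partial_derivative(2)[OF h z, of i], of "z $ i"]
    by (subst has_sum_cong[OF *[symmetric]])
qed (use h in \<open>simp add: power_series_on_def\<close>)

lemma power_series_at_0:
  assumes "power_series_on r h c" shows "h 0 = c 0"
proof -
  have "((\<lambda>\<nu>. c \<nu> * monom_val 0 \<nu>) has_sum h 0) UNIV"
    using assms zero_in_polydisc by (auto simp: power_series_on_def)
  then have "((\<lambda>\<nu>. c \<nu> * monom_val 0 \<nu>) has_sum h 0) {0}"
    by (subst has_sum_cong_neutral[where S = "{0}" and T = UNIV]) (auto simp: monom_val_at_0)
  then show ?thesis by (simp add: has_sum_finite_iff)
qed

text \<open>Uniqueness of the coefficients: the constant coefficient is the value at \<open>0\<close>, and a coefficient of
  positive degree is, up to a non-zero integer, a coefficient of lower degree of a partial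
  derivative.\<close>

lemma power_series_zero_coeffs:
  fixes h :: "complex^'n \<Rightarrow> complex"
  assumes "power_series_on r h c" "\<And>z. z \<in> polydisc r \<Longrightarrow> h z = 0"
  shows "c \<nu> = 0"
  using assms
proof (induction "total_degree \<nu>" arbitrary: \<nu> h c)
  case 0
  then have "\<nu> = 0" by (simp add: total_degree_def vec_eq_iff)
  then show ?case
    using power_series_at_0[OF "0.prems"(1)] "0.prems"(2)[OF zero_in_polydisc] "0.prems"(1)
    by (simp add: power_series_on_def)
next
  case (Suc d)
  then obtain i where i: "\<nu> $ i \<noteq> 0" by (fastforce simp: total_degree_def)
  define \<mu> where "\<mu> = \<nu> - axis i 1"
  have \<nu>: "\<nu> = \<mu> + axis i 1" using i by (auto simp: \<mu>_def vec_eq_iff axis_def)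
  have "total_degree \<nu> = total_degree \<mu> + (\<Sum>l\<in>UNIV. axis i 1 $ l)"
    unfolding \<nu> total_degree_def by (simp add: sum.distrib)
  then have "d = total_degree \<mu>" using Suc(2) by (simp add: axis_def)
  moreover have "cgrad h z $ i = 0" if z: "z \<in> polydisc r" for z
  proof -
    let ?p = "\<lambda>w. (\<chi> l. if l = i then w else z $ l) :: complex^'n"
    have "?p (z $ i) = z" by (simp add: vec_eq_iff)
    moreover have "open (?p -` polydisc r)"
    proof (intro open_vimage open_polydisc continuous_on_vec_lambda)
      show "continuous_on UNIV (\<lambda>w. if l = i then w else z $ l)" for l
        by (cases "l = i") auto
    qed
    ultimately have "\<forall>\<^sub>F w in nhds (z $ i). ?p w \<in> polydisc r"
      using z eventually_nhds_in_open[of "?p -` polydisc r" "z $ i"] by simp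
    then have "\<forall>\<^sub>F w in nhds (z $ i). h (?p w) = 0"
      by (rule eventually_mono) (rule Suc.prems)
    then have "((\<lambda>w. h (?p w)) has_field_derivative 0) (at (z $ i))"
      by (subst DERIV_cong_ev[where g = "\<lambda>_. 0"]) auto
    then show ?thesis
      using power_series_partial_derivative(1)[OF Suc.prems(1) z, of i] DERIV_unique by blast
  qed
  ultimately have "of_nat (\<mu> $ i + 1) * c (\<mu> + axis i 1) = 0"
    using Suc.hyps(1)[OF _ power_series_gradient[OF Suc.prems(1), of i], of \<mu>] by blast
  then show ?case unfolding \<nu>
    by (metis add.commute mult_eq_0_iff of_nat_eq_0_iff plus_1_eq_Suc nat.distinct(1))
qed

lemma taylor_coeff_eq:
  assumes "has_power_series_0 h c" shows "taylor_coeff h = c"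
  unfolding taylor_coeff_def
proof (rule the_equality)
  fix d assume "has_power_series_0 h d"
  with assms obtain r s where rs: "power_series_on r h c" "power_series_on s h d"
    by (auto simp: has_power_series_0_iff)
  define t where "t = min r s"
  have "0 < t" using rs by (simp add: t_def power_series_on_def)
  then have "power_series_on t (\<lambda>z. h z - h z) (\<lambda>\<nu>. c \<nu> - d \<nu>)"
    using rs by (intro power_series_on_diff) (auto intro: power_series_on_mono simp: t_def)
  from power_series_zero_coeffs[OF this] show "d = c" by (simp add: fun_eq_iff)
qed fact

lemma analytic_at_0_power_series:
  assumes "analytic_at_0 h"
  obtains r where "power_series_on r h (taylor_coeff h)"
  using assms taylor_coeff_eq unfolding analytic_at_0_def has_power_series_0_iff[symmetric]
  by (metis has_power_series_0_iff)

lemma finite_multiindices_le: "finite {\<mu> :: nat^'n. \<mu> \<le> \<nu>}"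
proof -
  have "{\<mu>. \<mu> \<le> \<nu>} \<subseteq> (\<lambda>f. \<chi> i. f i) ` (PiE UNIV (\<lambda>i. {..\<nu> $ i}))"
  proof
    fix \<mu> assume "\<mu> \<in> {\<mu>. \<mu> \<le> \<nu>}"
    then show "\<mu> \<in> (\<lambda>f. \<chi> i. f i) ` (PiE UNIV (\<lambda>i. {..\<nu> $ i}))"
      by (intro image_eqI[where x = "\<lambda>i. \<mu> $ i"]) (auto simp: less_eq_vec_def)
  qed
  then show ?thesis by (rule finite_subset) (auto intro!: finite_imageI finite_PiE)
qed

text \<open>The Cauchy product: the unconditionally convergent double series is regrouped along the
  bijection \<open>(\<mu>, \<nu>) \<mapsto> (\<mu> + \<nu>, \<mu>)\<close>, whose fibres over the first component are finite.\<close>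

lemma power_series_on_mult:
  fixes h g :: "complex^'n \<Rightarrow> complex"
  assumes h: "power_series_on r h c" and g: "power_series_on r g d"
  shows "\<exists>e. power_series_on r (\<lambda>z. h z * g z) e"
proof
  let ?e = "\<lambda>\<nu>. \<Sum>\<mu> | \<mu> \<le> \<nu>. c \<mu> * d (\<nu> - \<mu>)"
  have "((\<lambda>\<nu>. ?e \<nu> * monom_val z \<nu>) has_sum h z * g z) UNIV" if z: "z \<in> polydisc r" for z
  proof -
    let ?a = "\<lambda>\<nu>. c \<nu> * monom_val z \<nu>" and ?b = "\<lambda>\<nu>. d \<nu> * monom_val z \<nu>"
    have a: "(?a has_sum h z) UNIV" and b: "(?b has_sum g z) UNIV"
      using h g z by (auto simp: power_series_on_def)
    have as: "(\<lambda>\<nu>. norm (?a \<nu>)) summable_on UNIV" and bs: "(\<lambda>\<nu>. norm (?b \<nu>)) summable_on UNIV"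
      using has_sum_imp_summable[OF a] has_sum_imp_summable[OF b]
      by (simp_all add: summable_on_iff_abs_summable_on_complex)
    have "(\<lambda>x. norm (case x of (\<mu>, \<nu>) \<Rightarrow> ?a \<mu> * ?b \<nu>)) summable_on UNIV \<times> UNIV"
      by (subst Infinite_Sum.abs_summable_on_Sigma_iff)
        (use as bs in \<open>auto simp: norm_mult infsum_cmult_right' abs_mult
           intro!: summable_on_cmult_right summable_on_cmult_left\<close>)
    then have "(\<lambda>(\<mu>, \<nu>). ?a \<mu> * ?b \<nu>) summable_on UNIV \<times> UNIV"
      by (rule abs_summable_summable)
    then have ab: "((\<lambda>(\<mu>, \<nu>). ?a \<mu> * ?b \<nu>) has_sum h z * g z) (UNIV \<times> UNIV)"
      by (intro has_sum_SigmaI[where g = "\<lambda>\<mu>. ?a \<mu> * g z"])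
         (auto intro!: has_sum_cmult_right has_sum_cmult_left a b)
    have "((\<lambda>(\<nu>, \<mu>). c \<mu> * d (\<nu> - \<mu>) * monom_val z \<nu>) has_sum h z * g z) (SIGMA \<nu>:UNIV. {\<mu>. \<mu> \<le> \<nu>})"
    proof (rule iffD1[OF has_sum_reindex_bij_witness ab])
      show "(case (\<lambda>(\<mu>, \<nu>). (\<mu> + \<nu>, \<mu>)) x of (\<nu>, \<mu>) \<Rightarrow> c \<mu> * d (\<nu> - \<mu>) * monom_val z \<nu>) =
            (case x of (\<mu>, \<nu>) \<Rightarrow> ?a \<mu> * ?b \<nu>)" for x
        by (cases x) (simp add: monom_val_add)
      show "(\<lambda>(\<nu>, \<mu>). (\<mu>, \<nu> - \<mu>)) ((\<lambda>(\<mu>, \<nu>). (\<mu> + \<nu>, \<mu>)) x) = x" for x :: "(nat^'n) \<times> (nat^'n)"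
        by (cases x) simp
      show "(\<lambda>(\<mu>, \<nu>). (\<mu> + \<nu>, \<mu>)) ((\<lambda>(\<nu>, \<mu>). (\<mu>, \<nu> - \<mu>)) x) = x"
        if "x \<in> (SIGMA \<nu>:UNIV. {\<mu>. \<mu> \<le> \<nu>})" for x :: "(nat^'n) \<times> (nat^'n)"
        using that by (cases x) (auto simp: vec_eq_iff less_eq_vec_def)
    qed (auto simp: less_eq_vec_def)
    then show ?thesis
      by (rule has_sum_SigmaD) (auto simp: sum_distrib_right finite_multiindices_le intro!: has_sum_finite)
  qed
  then show "power_series_on r (\<lambda>z. h z * g z) ?e"
    using h by (auto simp: power_series_on_def)
qed

lemma power_series_on_prod:
  assumes "finite S" "0 < r" "\<And>\<alpha>. \<alpha> \<in> S \<Longrightarrow> \<exists>c. power_series_on r (h \<alpha>) c"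
  shows "\<exists>c. power_series_on r (\<lambda>z. \<Prod>\<alpha>\<in>S. h \<alpha> z) c"
  using assms(1,3)
proof (induction S)
  case empty
  then show ?case using power_series_on_const[OF assms(2), of 1] by auto
next
  case (insert a S)
  then show ?case using power_series_on_mult[of r "h a" _ "\<lambda>z. \<Prod>\<alpha>\<in>S. h \<alpha> z"] by fastforce
qed

section \<open>Newton polyhedra, their points on the axes and their weighted faces\<close>

lemma newton_polyhedron_least:
  assumes "convex K"
    and "\<And>\<nu> x. taylor_coeff h \<nu> \<noteq> 0 \<Longrightarrow> (\<And>i. 0 \<le> x $ i) \<Longrightarrow> exponent_point \<nu> + x \<in> K"
  shows "newton_polyhedron h \<subseteq> K"
  unfolding newton_polyhedron_def by (rule hull_minimal) (use assms in auto)

lemma newton_polyhedron_contains: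
  assumes "taylor_coeff h \<nu> \<noteq> 0" "\<And>i. 0 \<le> x $ i"
  shows "exponent_point \<nu> + x \<in> newton_polyhedron h"
  unfolding newton_polyhedron_def by (rule hull_inc) (use assms in auto)

lemma newton_polyhedron_exponent:
  assumes "taylor_coeff h \<nu> \<noteq> 0" shows "exponent_point \<nu> \<in> newton_polyhedron h"
  using newton_polyhedron_contains[OF assms, of 0] by simp

lemma convex_newton_polyhedron: "convex (newton_polyhedron h)"
  unfolding newton_polyhedron_def by (rule convex_convex_hull)

lemma exponent_point_axis: "exponent_point (axis j m) = axis j (real m)"
  by (simp add: exponent_point_def axis_def vec_eq_iff)

lemma exponent_point_add: "exponent_point (\<mu> + \<nu>) = exponent_point \<mu> + exponent_point \<nu>"
  by (simp add: exponent_point_def vec_eq_iff)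

text \<open>A convex combination, with positive coefficients, of points of the closed positive orthant lies on a
  coordinate axis only if all of them do. Hence only monomials that are powers of \<open>z\<^sub>j\<close> contribute to the part of the polyhedron on
  the \<open>j\<close>-th axis. The set \<open>K\<close> below expresses this as one convex set containing all generators.\<close>

lemma newton_polyhedron_meets_axis:
  fixes h :: "complex^'n \<Rightarrow> complex"
  assumes x: "x \<in> newton_polyhedron h" "\<And>i. i \<noteq> j \<Longrightarrow> x $ i = 0"
  shows "\<exists>b. taylor_coeff h (axis j b) \<noteq> 0"
    and "real (LEAST b. taylor_coeff h (axis j b) \<noteq> 0) \<le> x $ j"
proof -
  let ?E = "\<exists>b. taylor_coeff h (axis j b) \<noteq> 0"
  let ?b = "LEAST b. taylor_coeff h (axis j b) \<noteq> 0"
  define K where "K = {x :: real^'n. (\<forall>i. 0 \<le> x $ i) \<and> ((\<exists>i. i \<noteq> j \<and> 0 < x $ i) \<or> (?E \<and> real ?b \<le> x $ j))}"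
  have "convex K"
  proof (rule convexI)
    fix x y :: "real^'n" and u v :: real
    assume xy: "x \<in> K" "y \<in> K" and uv: "0 \<le> u" "0 \<le> v" "u + v = 1"
    have nn: "0 \<le> (u *\<^sub>R x + v *\<^sub>R y) $ i" for i using xy uv by (simp add: K_def)
    consider "u = 0" | "v = 0" | "0 < u" "0 < v" using uv by linarith
    then show "u *\<^sub>R x + v *\<^sub>R y \<in> K"
    proof cases
      case 3
      show ?thesis
      proof (cases "\<exists>i. i \<noteq> j \<and> (0 < x $ i \<or> 0 < y $ i)")
        case True
        then obtain i where i: "i \<noteq> j" "0 < x $ i \<or> 0 < y $ i" by blast
        have "0 \<le> x $ i" "0 \<le> y $ i" using xy by (auto simp: K_def)
        then have "0 < (u *\<^sub>R x + v *\<^sub>R y) $ i" using i(2) 3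
          by (auto intro: add_pos_nonneg add_nonneg_pos)
        then show ?thesis using nn i(1) by (auto simp: K_def)
      next
        case False
        then have E: "?E" "real ?b \<le> x $ j" "real ?b \<le> y $ j" using xy by (auto simp: K_def)
        have "real ?b = u * real ?b + v * real ?b" using uv by (simp flip: distrib_right)
        also have "\<dots> \<le> (u *\<^sub>R x + v *\<^sub>R y) $ j" using E 3
          by (simp add: add_mono mult_left_mono)
        finally show ?thesis using nn E(1) by (auto simp: K_def)
      qed
    qed (use xy uv in auto)
  qed
  then have "newton_polyhedron h \<subseteq> K"
  proof (rule newton_polyhedron_least)
    fix \<nu> and x :: "real^'n"
    assume \<nu>: "taylor_coeff h \<nu> \<noteq> 0" and x: "\<And>i. 0 \<le> x $ i"
    show "exponent_point \<nu> + x \<in> K"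
    proof (cases "\<exists>i. i \<noteq> j \<and> \<nu> $ i \<noteq> 0")
      case True
      then show ?thesis using x by (auto simp: K_def exponent_point_def intro!: add_pos_nonneg)
    next
      case False
      then have "\<nu> = axis j (\<nu> $ j)" by (auto simp: vec_eq_iff axis_def)
      then have "taylor_coeff h (axis j (\<nu> $ j)) \<noteq> 0" using \<nu> by simp
      moreover from this have "?b \<le> \<nu> $ j" by (rule Least_le)
      then have "real ?b \<le> (exponent_point \<nu> + x) $ j"
        using x[of j] of_nat_mono[of ?b "\<nu> $ j", where 'a = real] by (simp add: exponent_point_def)
      moreover have "0 \<le> (exponent_point \<nu> + x) $ i" for i using x by (simp add: exponent_point_def)
      ultimately show ?thesis unfolding K_def by blast
    qed
  qed
  then have "x \<in> K" using x by blast
  then show "?E" "real ?b \<le> x $ j" using x(2) by (auto simp: K_def)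
qed

text \<open>Beyond the least pure power the axis runs in the polyhedron; a face containing an interior point of
  this ray contains the whole ray and is not compact.\<close>

lemma newton_boundary_on_axis:
  fixes h :: "complex^'n \<Rightarrow> complex"
  assumes x: "x \<in> newton_boundary h" "\<And>i. i \<noteq> j \<Longrightarrow> x $ i = 0"
  shows "x $ j = real (LEAST b. taylor_coeff h (axis j b) \<noteq> 0)"
proof (rule ccontr)
  let ?b = "LEAST b. taylor_coeff h (axis j b) \<noteq> 0"
  obtain F where F: "F face_of newton_polyhedron h" "compact F" "x \<in> F"
    using x by (auto simp: newton_boundary_def)
  have xN: "x \<in> newton_polyhedron h" using F face_of_imp_subset by blast
  have ex: "\<exists>b. taylor_coeff h (axis j b) \<noteq> 0" and ge: "real ?b \<le> x $ j"
    by (rule newton_polyhedron_meets_axis[OF xN x(2)]; assumption)+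
  have b: "taylor_coeff h (axis j ?b) \<noteq> 0" using ex by (rule LeastI_ex)
  assume "x $ j \<noteq> real ?b"
  then have less: "real ?b < x $ j" using ge by simp
  have "axis j T \<in> F" if T: "x $ j < T" for T
  proof -
    have "axis j T = exponent_point (axis j ?b) + axis j (T - real ?b)"
      unfolding exponent_point_axis by (simp add: vec_eq_iff axis_def)
    then have TN: "axis j T \<in> newton_polyhedron h"
      using newton_polyhedron_contains[OF b, of "axis j (T - real ?b)"] less T by (auto simp: axis_def)
    let ?u = "(x $ j - real ?b) / (T - real ?b)"
    have u: "0 < ?u" "?u < 1" using less T by auto
    have "x = (1 - ?u) *\<^sub>R axis j (real ?b) + ?u *\<^sub>R axis j T"
    proof -
      have "x $ j = (1 - ?u) * real ?b + ?u * T"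
      proof -
        have "(1 - ?u) * real ?b + ?u * T = real ?b + ?u * (T - real ?b)" by (simp only: algebra_simps)
        also have "?u * (T - real ?b) = x $ j - real ?b" using less T by simp
        finally show ?thesis by simp
      qed
      then show ?thesis using x(2) by (auto simp: vec_eq_iff axis_def)
    qed
    moreover have "axis j (real ?b) \<noteq> (axis j T :: real^'n)"
      using less T by (auto simp: axis_eq_axis)
    ultimately have "x \<in> open_segment (axis j (real ?b)) (axis j T)"
      using u by (auto simp: in_segment intro!: exI[of _ ?u])
    moreover have "axis j (real ?b) \<in> newton_polyhedron h"
      using newton_polyhedron_exponent[OF b] by (simp add: exponent_point_axis)
    ultimately show ?thesis using F TN unfolding face_of_def by blast
  qed
  moreover obtain C where C: "\<And>y. y \<in> F \<Longrightarrow> norm y \<le> C"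
    using compact_imp_bounded[OF F(2)] by (auto simp: bounded_iff)
  ultimately have "norm (axis j T :: real^'n) \<le> C" if "x $ j < T" for T using that by blast
  moreover define T where "T = \<bar>x $ j\<bar> + \<bar>C\<bar> + 1"
  ultimately have "norm (axis j T :: real^'n) \<le> C" by simp
  moreover have "T \<le> norm (axis j T :: real^'n)"
    using component_le_norm_cart[of "axis j T :: real^'n" j] by simp
  moreover have "C < T" unfolding T_def by linarith
  ultimately show False by simp
qed

text \<open>The least pure power of \<open>z\<^sub>j\<close>, of exponent \<open>b\<close> say, is a vertex: the weight \<open>1\<close> on the \<open>j\<close>-th
  coordinate and \<open>b + 1\<close> on the others has its strict minimum there, because any monomial
  involving another variable has weight at least \<open>b + 1\<close>.\<close>

lemma axis_point_in_newton_boundary: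
  fixes h :: "complex^'n \<Rightarrow> complex"
  assumes ex: "\<exists>b. taylor_coeff h (axis j b) \<noteq> 0"
  shows "axis j (real (LEAST b. taylor_coeff h (axis j b) \<noteq> 0)) \<in> newton_boundary h"
proof -
  let ?b = "LEAST b. taylor_coeff h (axis j b) \<noteq> 0"
  let ?p = "axis j (real ?b) :: real^'n"
  define P :: "real^'n" where "P = (\<chi> i. if i = j then 1 else real ?b + 1)"
  have b: "taylor_coeff h (axis j ?b) \<noteq> 0" using ex by (rule LeastI_ex)
  have Paxis: "P \<bullet> axis j t = t" for t by (simp add: inner_axis P_def)
  have Pp: "P \<bullet> ?p = real ?b" by (rule Paxis)
  have pN: "?p \<in> newton_polyhedron h"
    using newton_polyhedron_exponent[OF b] by (simp add: exponent_point_axis)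
  define K where "K = insert ?p {x. real ?b < P \<bullet> x}"
  have ge: "real ?b \<le> P \<bullet> x" if "x \<in> K" for x using that Pp by (auto simp: K_def)
  have "convex K"
  proof (rule convexI)
    fix x y :: "real^'n" and u v :: real
    assume xy: "x \<in> K" "y \<in> K" and uv: "0 \<le> u" "0 \<le> v" "u + v = 1"
    consider "u = 0" | "v = 0" | "x = ?p" "y = ?p" | "0 < u" "0 < v" "real ?b < P \<bullet> x \<or> real ?b < P \<bullet> y"
      using uv xy unfolding K_def by (cases "u = 0"; cases "v = 0"; cases "x = ?p"; cases "y = ?p") auto
    then show "u *\<^sub>R x + v *\<^sub>R y \<in> K"
    proof cases
      case 3
      then show ?thesis using uv by (simp add: K_def flip: scaleR_left_distrib)
    next
      case 4
      have "0 < u * (P \<bullet> x - real ?b) + v * (P \<bullet> y - real ?b)"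
        using 4 ge[OF xy(1)] ge[OF xy(2)] by (auto intro: add_pos_nonneg add_nonneg_pos)
      also have "\<dots> = P \<bullet> (u *\<^sub>R x + v *\<^sub>R y) - (u + v) * real ?b"
        by (simp add: inner_add_right algebra_simps)
      finally show ?thesis using uv by (simp add: K_def)
    qed (use xy uv in auto)
  qed
  then have sub: "newton_polyhedron h \<subseteq> K"
  proof (rule newton_polyhedron_least)
    fix \<nu> and x :: "real^'n"
    assume \<nu>: "taylor_coeff h \<nu> \<noteq> 0" and x: "\<And>i. 0 \<le> x $ i"
    let ?y = "exponent_point \<nu> + x"
    have y: "0 \<le> ?y $ i" for i using x by (simp add: exponent_point_def)
    have P: "P \<bullet> ?y = ?y $ j + (\<Sum>i\<in>UNIV - {j}. (real ?b + 1) * ?y $ i)"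
      unfolding inner_vec_def by (subst sum.remove[of _ j]) (auto simp: P_def intro!: sum.cong)
    show "?y \<in> K"
    proof (cases "\<exists>i. i \<noteq> j \<and> ?y $ i \<noteq> 0")
      case True
      then obtain i where i: "i \<noteq> j" "0 < ?y $ i" using y by (metis order_le_less)
      show ?thesis
      proof (cases "\<exists>i. i \<noteq> j \<and> \<nu> $ i \<noteq> 0")
        case True
        then obtain l where l: "l \<noteq> j" "\<nu> $ l \<noteq> 0" by blast
        have "1 \<le> ?y $ l" using l(2) x[of l] by (simp add: exponent_point_def)
        then have "real ?b + 1 \<le> (real ?b + 1) * ?y $ l" by simp
        also have "\<dots> \<le> (\<Sum>i\<in>UNIV - {j}. (real ?b + 1) * ?y $ i)"
          by (rule member_le_sum) (use l y in auto)
        finally show ?thesis using P y[of j] by (simp add: K_def)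
      next
        case False
        then have "\<nu> = axis j (\<nu> $ j)" by (auto simp: vec_eq_iff axis_def)
        then have "taylor_coeff h (axis j (\<nu> $ j)) \<noteq> 0" using \<nu> by simp
        then have "?b \<le> \<nu> $ j" by (rule Least_le)
        then have "real ?b \<le> ?y $ j" using x[of j] of_nat_mono[of ?b "\<nu> $ j", where 'a = real]
          by (simp add: exponent_point_def)
        moreover have "0 < (\<Sum>i\<in>UNIV - {j}. (real ?b + 1) * ?y $ i)"
          using i y by (intro sum_pos2[of _ i]) auto
        ultimately show ?thesis using P by (simp add: K_def)
      qed
    next
      case False
      then have "\<nu> $ i = 0" if "i \<noteq> j" for i using that x[of i] by (auto simp: exponent_point_def)
      then have "\<nu> = axis j (\<nu> $ j)" by (auto simp: vec_eq_iff axis_def)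
      then have "taylor_coeff h (axis j (\<nu> $ j)) \<noteq> 0" using \<nu> by simp
      then have "?b \<le> \<nu> $ j" by (rule Least_le)
      then have ge: "real ?b \<le> ?y $ j" using x[of j] of_nat_mono[of ?b "\<nu> $ j", where 'a = real]
        by (simp add: exponent_point_def)
      have yj: "?y = axis j (?y $ j)" using False by (auto simp: vec_eq_iff axis_def)
      then have "P \<bullet> ?y = ?y $ j" using Paxis by metis
      then show ?thesis using ge yj by (cases "?y $ j = real ?b") (auto simp: K_def)
    qed
  qed
  have "newton_polyhedron h \<inter> {x. P \<bullet> x = real ?b} face_of newton_polyhedron h"
    by (rule face_of_Int_supporting_hyperplane_ge[OF convex_newton_polyhedron]) (use sub ge in blast)
  moreover have "newton_polyhedron h \<inter> {x. P \<bullet> x = real ?b} = {?p}"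
    using sub pN Pp by (auto simp: K_def)
  ultimately show ?thesis unfolding newton_boundary_def by auto
qed

lemma axis_exponent_eq_Least:
  assumes "\<exists>b. taylor_coeff h (axis j b) \<noteq> 0"
  shows "axis_exponent h j = (LEAST b. taylor_coeff h (axis j b) \<noteq> 0)"
  unfolding axis_exponent_def
proof (rule the_equality)
  fix b assume "axis j (real b) \<in> newton_boundary h"
  then have "(axis j (real b) :: real^'a) $ j = real (LEAST b. taylor_coeff h (axis j b) \<noteq> 0)"
    by (rule newton_boundary_on_axis) (simp add: axis_def)
  then show "b = (LEAST b. taylor_coeff h (axis j b) \<noteq> 0)" by simp
qed (rule axis_point_in_newton_boundary[OF assms])

lemma convenient_axis_monomial:
  assumes "convenient h"
  shows "taylor_coeff h (axis j (axis_exponent h j)) \<noteq> 0"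
proof -
  obtain x where x: "x \<in> newton_boundary h" "\<And>i. i \<noteq> j \<Longrightarrow> x $ i = 0"
    using assms by (auto simp: convenient_def)
  then have "x \<in> newton_polyhedron h" using face_of_imp_subset by (auto simp: newton_boundary_def)
  then have ex: "\<exists>b. taylor_coeff h (axis j b) \<noteq> 0" using newton_polyhedron_meets_axis(1) x(2) by blast
  then show ?thesis unfolding axis_exponent_eq_Least[OF ex] by (rule LeastI_ex)
qed

lemma weight_le_on_newton_polyhedron:
  assumes "strictly_positive P" "\<And>\<nu>. taylor_coeff h \<nu> \<noteq> 0 \<Longrightarrow> m \<le> P \<bullet> exponent_point \<nu>"
    and "x \<in> newton_polyhedron h"
  shows "m \<le> P \<bullet> x"
proof -
  have "newton_polyhedron h \<subseteq> {x. m \<le> P \<bullet> x}"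
  proof (rule newton_polyhedron_least)
    show "convex {x. m \<le> P \<bullet> x}" using convex_halfspace_ge[of m P] by simp
    fix \<nu> and x :: "real^'a"
    assume "taylor_coeff h \<nu> \<noteq> 0" and x: "\<And>i. 0 \<le> x $ i"
    moreover have "0 \<le> P \<bullet> x" unfolding inner_vec_def
      using assms(1) x by (auto simp: strictly_positive_def less_imp_le intro!: sum_nonneg)
    ultimately show "exponent_point \<nu> + x \<in> {x. m \<le> P \<bullet> x}"
      using assms(2)[of \<nu>] by (simp add: inner_add_right)
  qed
  then show ?thesis using assms(3) by blast
qed

text \<open>The exponents of minimal weight carry the face function. The index set in the definition of the face
  function may contain lattice points of the face at which the coefficient vanishes; strict
  positivity of \<open>P\<close> makes it finite, so that these drop out of the sum.\<close>

lemma face_function_eq_sum: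
  fixes h :: "complex^'n \<Rightarrow> complex"
  assumes P: "strictly_positive P" and T: "finite T" "T \<noteq> {}"
    and supp: "\<And>\<nu>. \<nu> \<in> T \<Longrightarrow> taylor_coeff h \<nu> \<noteq> 0"
    and eq: "\<And>\<nu>. \<nu> \<in> T \<Longrightarrow> P \<bullet> exponent_point \<nu> = m"
    and less: "\<And>\<nu>. taylor_coeff h \<nu> \<noteq> 0 \<Longrightarrow> \<nu> \<notin> T \<Longrightarrow> m < P \<bullet> exponent_point \<nu>"
  shows "face_function P h = (\<lambda>z. \<Sum>\<nu>\<in>T. taylor_coeff h \<nu> * monom_val z \<nu>)"
proof
  fix z
  let ?W = "{\<nu>. exponent_point \<nu> \<in> weight_face P h}"
  obtain \<mu> where \<mu>: "\<mu> \<in> T" using T(2) by blast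
  have ge: "m \<le> P \<bullet> exponent_point \<nu>" if "taylor_coeff h \<nu> \<noteq> 0" for \<nu>
    using eq[of \<nu>] less[OF that] by (cases "\<nu> \<in> T") auto
  have le: "P \<bullet> exponent_point \<nu> \<le> m" if "\<nu> \<in> ?W" for \<nu>
    using that newton_polyhedron_exponent[OF supp[OF \<mu>]] eq[OF \<mu>] by (auto simp: weight_face_def)
  have "?W \<subseteq> {\<nu>. \<nu> \<le> (\<chi> i. nat \<lfloor>m / P $ i\<rfloor>)}"
  proof
    fix \<nu> assume \<nu>: "\<nu> \<in> ?W"
    have "\<nu> $ i \<le> nat \<lfloor>m / P $ i\<rfloor>" for i
    proof -
      have Pi: "0 < P $ l" for l using P by (simp add: strictly_positive_def)
      have "P $ i * real (\<nu> $ i) \<le> (\<Sum>l\<in>UNIV. P $ l * real (\<nu> $ l))"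
        by (rule member_le_sum) (use Pi in \<open>auto simp: less_imp_le\<close>)
      also have "\<dots> \<le> m" using le[OF \<nu>] by (simp add: inner_vec_def exponent_point_def)
      finally have "real (\<nu> $ i) \<le> m / P $ i" using Pi[of i] by (simp add: field_simps)
      then show ?thesis by (simp add: le_nat_iff le_floor_iff)
    qed
    then show "\<nu> \<in> {\<nu>. \<nu> \<le> (\<chi> i. nat \<lfloor>m / P $ i\<rfloor>)}" by (simp add: less_eq_vec_def)
  qed
  then have fin: "finite ?W" by (rule finite_subset) (rule finite_multiindices_le)
  have sub: "T \<subseteq> ?W"
    using newton_polyhedron_exponent[OF supp] eq weight_le_on_newton_polyhedron[OF P ge]
    by (auto simp: weight_face_def)
  have zero: "taylor_coeff h \<nu> = 0" if "\<nu> \<in> ?W - T" for \<nu>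
    using that le[of \<nu>] less[of \<nu>] by force
  show "face_function P h z = (\<Sum>\<nu>\<in>T. taylor_coeff h \<nu> * monom_val z \<nu>)"
    unfolding face_function_def by (rule sum.mono_neutral_right[OF fin sub]) (simp add: zero)
qed

section \<open>Limits of monomials along sequences in the torus\<close>

lemma finite_family_convergent_subsequence:
  fixes X :: "(nat \<Rightarrow> complex) set"
  assumes "finite X" "\<And>s. s \<in> X \<Longrightarrow> bounded (range s)"
  shows "\<exists>r::nat \<Rightarrow> nat. strict_mono r \<and> (\<forall>s\<in>X. convergent (s \<circ> r))"
  using assms
proof (induction X)
  case empty
  show ?case by (intro exI[of _ id]) (auto simp: strict_mono_def)
next
  case (insert t X)
  then have "\<exists>r::nat \<Rightarrow> nat. strict_mono r \<and> (\<forall>s\<in>X. convergent (s \<circ> r))" by blast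
  then obtain r :: "nat \<Rightarrow> nat" where r: "strict_mono r" "\<forall>s\<in>X. convergent (s \<circ> r)" by blast
  have "bounded (range (t \<circ> r))"
    by (rule bounded_subset[of "range t"]) (use insert.prems in auto)
  then obtain l q where q: "strict_mono q" "((t \<circ> r) \<circ> q) \<longlonglongrightarrow> l"
    using bounded_imp_convergent_subsequence by blast
  have "convergent (s \<circ> (r \<circ> q))" if "s \<in> insert t X" for s
  proof (cases "s = t")
    case True
    then show ?thesis using q(2) by (auto simp: convergent_def o_assoc)
  next
    case False
    then have "convergent (s \<circ> r)" using that r(2) by simp
    then obtain l' where "(s \<circ> r) \<longlonglongrightarrow> l'" by (auto simp: convergent_def)
    then have "((s \<circ> r) \<circ> q) \<longlonglongrightarrow> l'" by (rule LIMSEQ_subseq_LIMSEQ) (rule q(1))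
    then show ?thesis by (auto simp: convergent_def o_assoc)
  qed
  then show ?case using strict_mono_o[OF r(1) q(1)] by blast
qed

text \<open>The directions in which \<open>x\<close> converges form a subspace \<open>V\<close>. The orthogonal projection of \<open>x\<close> to \<open>V\<close>
  converges, so subtracting it changes neither the vanishing on \<open>V\<close> nor the divergence in the
  directions \<open>D\<close>: a late member of the difference sequence is the desired functional. Applied to
  \<open>x\<^sub>i = - ln \<bar>z\<^sub>i\<bar>\<close>, this extracts one weight vector from a sequence whose coordinates may
  tend to \<open>0\<close> at incomparable rates.\<close>

lemma separating_functional_of_divergent_sequence:
  fixes x :: "nat \<Rightarrow> 'a::euclidean_space"
  assumes D: "finite D" "\<And>d. d \<in> D \<Longrightarrow> filterlim (\<lambda>m. x m \<bullet> d) at_top sequentially"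
  shows "\<exists>P y. (\<forall>d. convergent (\<lambda>m. x m \<bullet> d) \<longrightarrow> P \<bullet> d = 0 \<and> (\<lambda>m. x m \<bullet> d) \<longlonglongrightarrow> y \<bullet> d) \<and>
           (\<forall>d\<in>D. 0 < P \<bullet> d)"
proof -
  define V where "V = {d. convergent (\<lambda>m. x m \<bullet> d)}"
  have "subspace V"
    unfolding V_def subspace_def
    by (auto simp: inner_add_right intro: convergent_add convergent_mult convergent_const)
  then obtain B where B: "B \<subseteq> V" "pairwise orthogonal B" "\<And>b. b \<in> B \<Longrightarrow> norm b = 1"
      "independent B" "span B = V"
    using orthonormal_basis_subspace by metis
  have finB: "finite B" using B(4) by (rule independent_imp_finite)
  define yy where "yy m = (\<Sum>b\<in>B. (x m \<bullet> b) *\<^sub>R b)" for m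
  define y where "y = (\<Sum>b\<in>B. lim (\<lambda>m. x m \<bullet> b) *\<^sub>R b)"
  have yy: "yy \<longlonglongrightarrow> y"
    unfolding yy_def y_def
    by (intro tendsto_sum tendsto_scaleR tendsto_const) (use B(1) in \<open>auto simp: V_def convergent_LIMSEQ_iff\<close>)
  have orth: "(x m - yy m) \<bullet> d = 0" if "d \<in> V" for m d
  proof -
    have "orthogonal (x m - yy m) b" if b: "b \<in> B" for b
    proof -
      have "yy m \<bullet> b = (\<Sum>a\<in>B. if a = b then x m \<bullet> b else 0)"
        unfolding yy_def inner_sum_left
      proof (rule sum.cong)
        fix a assume "a \<in> B"
        then show "((x m \<bullet> a) *\<^sub>R a) \<bullet> b = (if a = b then x m \<bullet> b else 0)"
          using B(2,3) b by (auto simp: pairwise_def orthogonal_def dot_square_norm)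
      qed simp
      then show ?thesis using b finB by (simp add: orthogonal_def inner_diff_left)
    qed
    then show ?thesis using that B(5) orthogonal_to_span by (auto simp: orthogonal_def)
  qed
  have "\<forall>\<^sub>F m in sequentially. \<forall>d\<in>D. 0 < (x m - yy m) \<bullet> d"
  proof (rule eventually_ball_finite[OF D(1)], rule)
    fix d assume "d \<in> D"
    moreover have "(\<lambda>m. - (yy m \<bullet> d)) \<longlonglongrightarrow> - (y \<bullet> d)" by (intro tendsto_intros yy)
    ultimately have "filterlim (\<lambda>m. - (yy m \<bullet> d) + x m \<bullet> d) at_top sequentially"
      using D(2) filterlim_tendsto_add_at_top by blast
    then have "\<forall>\<^sub>F m in sequentially. 0 < - (yy m \<bullet> d) + x m \<bullet> d"
      unfolding filterlim_at_top_dense by blast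
    then show "\<forall>\<^sub>F m in sequentially. 0 < (x m - yy m) \<bullet> d"
      by (simp add: inner_diff_left)
  qed
  then obtain m where m: "\<forall>d\<in>D. 0 < (x m - yy m) \<bullet> d"
    using eventually_happens'[OF sequentially_bot] by blast
  have lim: "(\<lambda>m. x m \<bullet> d) \<longlonglongrightarrow> y \<bullet> d" if "d \<in> V" for d
  proof -
    have "(\<lambda>m. yy m \<bullet> d) \<longlonglongrightarrow> y \<bullet> d" by (intro tendsto_intros yy)
    then show ?thesis using orth[OF that] by (simp add: inner_diff_left)
  qed
  show ?thesis
  proof (intro exI conjI allI impI)
    show "(x m - yy m) \<bullet> d = 0" "(\<lambda>m. x m \<bullet> d) \<longlonglongrightarrow> y \<bullet> d" if "convergent (\<lambda>m. x m \<bullet> d)" for d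
      using that orth lim by (auto simp: V_def)
  qed (rule m)
qed

definition monom_size :: "(nat^'n) set \<Rightarrow> complex^'n \<Rightarrow> real" where
  "monom_size A z = (\<Sum>\<nu>\<in>A. norm (monom_val z \<nu>))"

text \<open>The strict gap \<open>axis j 1\<close> is what makes the remainder small compared with the monomials in \<open>A\<close>, and
  not just bounded by them.\<close>

definition dominates :: "(nat^'n) set \<Rightarrow> (nat^'n \<Rightarrow> complex) \<Rightarrow> bool" where
  "dominates A c \<longleftrightarrow> finite A \<and> (\<forall>\<nu>. c \<nu> \<noteq> 0 \<longrightarrow> \<nu> \<notin> A \<longrightarrow> (\<exists>\<mu>\<in>A. \<exists>j \<eta>. \<nu> = \<mu> + axis j 1 + \<eta>))"

lemma monom_size_nonneg: "0 \<le> monom_size A z"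
  by (simp add: monom_size_def sum_nonneg)

lemma monom_size_ge: "finite A \<Longrightarrow> \<nu> \<in> A \<Longrightarrow> norm (monom_val z \<nu>) \<le> monom_size A z"
  unfolding monom_size_def by (rule member_le_sum) auto

lemma monom_size_pos: "finite A \<Longrightarrow> A \<noteq> {} \<Longrightarrow> z \<in> complex_torus \<Longrightarrow> 0 < monom_size A z"
  unfolding monom_size_def by (rule sum_pos) (auto simp: monom_val_nonzero)

lemma total_degree_add: "total_degree (\<mu> + \<nu>) = total_degree \<mu> + total_degree \<nu>"
  by (simp add: total_degree_def sum.distrib)

lemma total_degree_axis: "total_degree (axis j m) = m"
  by (simp add: total_degree_def axis_def)

text \<open>A monomial outside \<open>A\<close> has the form \<open>z\<^sup>\<mu> z\<^sub>j z\<^sup>\<eta>\<close> with \<open>\<mu> \<in> A\<close>. The first factor is at most the size of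
  \<open>A\<close>, the second at most \<open>\<parallel>z\<parallel>\<close>, and the powers of \<open>\<rho>\<close> bounding the third are summable against the
  coefficients.\<close>

lemma power_series_remainder:
  fixes h :: "complex^'n \<Rightarrow> complex"
  assumes h: "power_series_on r h c" and A: "dominates A c"
  shows "\<exists>\<rho>>0. \<exists>C. \<forall>z\<in>polydisc \<rho>.
           norm (h z - (\<Sum>\<nu>\<in>A. c \<nu> * monom_val z \<nu>)) \<le> C * norm z * monom_size A z"
proof -
  have r: "0 < r" using h by (simp add: power_series_on_def)
  define \<rho> where "\<rho> = r / 2"
  have \<rho>: "0 < \<rho>" "\<rho> < r" using r by (auto simp: \<rho>_def)
  have finA: "finite A" using A by (simp add: dominates_def)
  define K where "K = (\<Sum>\<mu>\<in>A. 1 / \<rho> ^ (total_degree \<mu> + 1))"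
  define c' where "c' = (\<lambda>\<nu>. if \<nu> \<in> A then 0 else c \<nu>)"
  have "power_series_on r (\<lambda>z. h z - (\<Sum>\<nu>\<in>A. (if \<nu> \<in> A then c \<nu> else 0) * monom_val z \<nu>))
          (\<lambda>\<nu>. c \<nu> - (if \<nu> \<in> A then c \<nu> else 0))"
    by (intro power_series_on_diff h power_series_on_polynomial finA r) auto
  moreover have "(\<lambda>\<nu>. c \<nu> - (if \<nu> \<in> A then c \<nu> else 0)) = c'" by (auto simp: c'_def)
  moreover have "(\<lambda>z. h z - (\<Sum>\<nu>\<in>A. (if \<nu> \<in> A then c \<nu> else 0) * monom_val z \<nu>)) =
                 (\<lambda>z. h z - (\<Sum>\<nu>\<in>A. c \<nu> * monom_val z \<nu>))" by simp
  ultimately have rem: "power_series_on r (\<lambda>z. h z - (\<Sum>\<nu>\<in>A. c \<nu> * monom_val z \<nu>)) c'" by simp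
  let ?g = "\<lambda>\<nu>. norm (c \<nu>) * \<rho> ^ total_degree \<nu>"
  define S where "S = (\<Sum>\<^sub>\<infinity>\<nu>. ?g \<nu>)"
  have S: "(?g has_sum S) UNIV"
    unfolding S_def using power_series_summable[OF h] \<rho> by (intro has_sum_infsum) auto
  have "norm (h z - (\<Sum>\<nu>\<in>A. c \<nu> * monom_val z \<nu>)) \<le> S * K * norm z * monom_size A z"
    if z: "z \<in> polydisc \<rho>" for z
  proof -
    let ?M = "K * norm z * monom_size A z"
    have "z \<in> polydisc r" using z \<rho> polydisc_mono[of \<rho> r] by auto
    then have sum1: "((\<lambda>\<nu>. c' \<nu> * monom_val z \<nu>) has_sum (h z - (\<Sum>\<nu>\<in>A. c \<nu> * monom_val z \<nu>))) UNIV"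
      using rem by (simp add: power_series_on_def)
    have sum2: "((\<lambda>\<nu>. ?g \<nu> * ?M) has_sum (S * ?M)) UNIV" by (rule has_sum_cmult_left[OF S])
    have "norm (c' \<nu> * monom_val z \<nu>) \<le> ?g \<nu> * ?M" for \<nu>
    proof (cases "c' \<nu> = 0")
      case True
      then show ?thesis using \<rho> monom_size_nonneg[of A z]
        by (simp add: K_def sum_nonneg)
    next
      case False
      then have "c \<nu> \<noteq> 0" "\<nu> \<notin> A" by (auto simp: c'_def split: if_splits)
      then obtain \<mu> j \<eta> where \<mu>: "\<mu> \<in> A" "\<nu> = \<mu> + axis j 1 + \<eta>" using A by (auto simp: dominates_def)
      have e1: "norm (monom_val z \<mu>) \<le> monom_size A z" by (rule monom_size_ge) fact+
      have e2: "norm (z $ j) \<le> norm z" by (rule Finite_Cartesian_Product.norm_nth_le)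
      have e3: "norm (monom_val z \<eta>) \<le> \<rho> ^ total_degree \<eta>"
        by (rule norm_monom_val_le) (use z in \<open>auto simp: polydisc_def less_imp_le\<close>)
      have "\<rho> ^ total_degree \<eta> = \<rho> ^ total_degree \<nu> * (1 / \<rho> ^ (total_degree \<mu> + 1))"
        using \<rho> by (simp add: \<mu>(2) total_degree_add total_degree_axis power_add)
      also have "1 / \<rho> ^ (total_degree \<mu> + 1) \<le> K"
        unfolding K_def by (rule member_le_sum) (use \<mu> finA \<rho> in auto)
      finally have e4: "\<rho> ^ total_degree \<eta> \<le> \<rho> ^ total_degree \<nu> * K" using \<rho> by (simp add: mult_left_mono)
      have "norm (monom_val z \<nu>) = norm (monom_val z \<mu>) * norm (z $ j) * norm (monom_val z \<eta>)"
        by (simp add: \<mu>(2) monom_val_add monom_val_axis norm_mult)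
      also have "\<dots> \<le> monom_size A z * norm z * (\<rho> ^ total_degree \<nu> * K)"
        by (intro mult_mono e1 e2 order_trans[OF e3 e4] mult_nonneg_nonneg monom_size_nonneg) auto
      finally have "norm (c \<nu>) * norm (monom_val z \<nu>) \<le> norm (c \<nu>) * (monom_size A z * norm z * (\<rho> ^ total_degree \<nu> * K))"
        by (rule mult_left_mono) simp
      then show ?thesis using \<open>\<nu> \<notin> A\<close> by (simp add: c'_def norm_mult mult_ac)
    qed
    then have "norm (h z - (\<Sum>\<nu>\<in>A. c \<nu> * monom_val z \<nu>)) \<le> S * ?M"
      by (intro norm_infsum_le[OF sum1 sum2]) auto
    then show ?thesis by (simp add: mult_ac)
  qed
  then show ?thesis using \<rho> by blast
qed

lemma power_series_over_monom_size_tendsto: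
  fixes h :: "complex^'n \<Rightarrow> complex" and z :: "nat \<Rightarrow> complex^'n"
  assumes h: "power_series_on r h c" and A: "dominates A c" "A \<noteq> {}"
    and z: "\<And>m. z m \<in> complex_torus" "z \<longlonglongrightarrow> 0"
    and \<tau>: "\<And>\<nu>. \<nu> \<in> A \<Longrightarrow> (\<lambda>m. monom_val (z m) \<nu> / of_real (monom_size A (z m))) \<longlonglongrightarrow> \<tau> \<nu>"
  shows "(\<lambda>m. h (z m) / of_real (monom_size A (z m))) \<longlonglongrightarrow> (\<Sum>\<nu>\<in>A. c \<nu> * \<tau> \<nu>)"
proof -
  have finA: "finite A" using A by (simp add: dominates_def)
  obtain \<rho> C where \<rho>: "0 < \<rho>" and C: "\<And>z. z \<in> polydisc \<rho> \<Longrightarrow>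
      norm (h z - (\<Sum>\<nu>\<in>A. c \<nu> * monom_val z \<nu>)) \<le> C * norm z * monom_size A z"
    using power_series_remainder[OF h A(1)] by blast
  let ?M = "\<lambda>m. monom_size A (z m)"
  have M: "0 < ?M m" for m by (rule monom_size_pos[OF finA A(2) z(1)])
  have "\<forall>\<^sub>F m in sequentially. z m \<in> polydisc \<rho>"
    by (rule topological_tendstoD[OF z(2) open_polydisc zero_in_polydisc[OF \<rho>]])
  then have ev: "\<forall>\<^sub>F m in sequentially.
      norm ((h (z m) - (\<Sum>\<nu>\<in>A. c \<nu> * monom_val (z m) \<nu>)) / of_real (?M m)) \<le> C * norm (z m)"
  proof (rule eventually_mono)
    fix m assume "z m \<in> polydisc \<rho>"
    from C[OF this] show "norm ((h (z m) - (\<Sum>\<nu>\<in>A. c \<nu> * monom_val (z m) \<nu>)) / of_real (?M m)) \<le> C * norm (z m)"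
      using M[of m] by (simp add: norm_divide divide_le_eq)
  qed
  have "(\<lambda>m. C * norm (z m)) \<longlonglongrightarrow> C * norm (0 :: complex^'n)" by (intro tendsto_intros z)
  then have "(\<lambda>m. C * norm (z m)) \<longlonglongrightarrow> 0" by simp
  from Lim_null_comparison[OF ev this]
  have 1: "(\<lambda>m. (h (z m) - (\<Sum>\<nu>\<in>A. c \<nu> * monom_val (z m) \<nu>)) / of_real (?M m)) \<longlonglongrightarrow> 0" .
  have 2: "(\<lambda>m. \<Sum>\<nu>\<in>A. c \<nu> * (monom_val (z m) \<nu> / of_real (?M m))) \<longlonglongrightarrow> (\<Sum>\<nu>\<in>A. c \<nu> * \<tau> \<nu>)"
    by (intro tendsto_intros \<tau>)
  have "(\<lambda>m. (h (z m) - (\<Sum>\<nu>\<in>A. c \<nu> * monom_val (z m) \<nu>)) / of_real (?M m) +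
             (\<Sum>\<nu>\<in>A. c \<nu> * (monom_val (z m) \<nu> / of_real (?M m)))) =
        (\<lambda>m. h (z m) / of_real (?M m))"
    by (simp add: diff_divide_distrib sum_divide_distrib)
  then show ?thesis using tendsto_add[OF 1 2] by simp
qed

text \<open>For \<open>a\<close> with coordinates of modulus one this separates the arguments from the logarithmic moduli
  \<open>- x\<close>, in which the logarithm of a monomial is linear.\<close>

lemma monom_val_polar:
  "monom_val (\<chi> i. a $ i * of_real (exp (- (x $ i)))) \<nu> =
   monom_val a \<nu> * of_real (exp (- (x \<bullet> exponent_point \<nu>)))"
proof -
  have "(\<Prod>i\<in>UNIV. exp (- (x $ i)) ^ (\<nu> $ i)) = exp (- (x \<bullet> exponent_point \<nu>))"
    by (simp add: inner_vec_def exponent_point_def exp_sum[symmetric] sum_negf[symmetric]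
        exp_of_nat_mult[symmetric] mult.commute)
  then show ?thesis
    by (simp add: monom_val_def power_mult_distrib prod.distrib flip: of_real_power of_real_prod)
qed

lemma polar_coordinates:
  assumes "z \<in> complex_torus"
  shows "z = (\<chi> i. (\<chi> i. sgn (z $ i)) $ i * of_real (exp (- ((\<chi> i. - ln (norm (z $ i))) $ i))))"
  using assms by (auto simp: vec_eq_iff complex_torus_def sgn_div_norm scaleR_conv_of_real)

text \<open>Suppose that the monomials in each finite set \<open>A \<alpha>\<close>, normalised by their total size, converge along
  a sequence of torus points tending to \<open>0\<close>. The monomials with non-zero limit are those of minimal
  \<open>P\<close>-weight for one common strictly positive \<open>P\<close>: their logarithmic sizes differ by convergent
  sequences, whereas all others, and all coordinates, decay relative to them. The argument limits \<open>\<phi>\<close>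
  and the limit \<open>y\<close> of the projected logarithms assemble to the point \<open>w\<close>.\<close>

lemma monomial_limits_on_face:
  fixes z :: "nat \<Rightarrow> complex^'n" and A :: "'a \<Rightarrow> (nat^'n) set"
  assumes z: "\<And>m. z m \<in> complex_torus" "z \<longlonglongrightarrow> 0"
    and \<phi>: "\<And>i. (\<lambda>m. sgn (z m $ i)) \<longlonglongrightarrow> \<phi> i"
    and S: "finite S"
    and A: "\<And>\<alpha>. \<alpha> \<in> S \<Longrightarrow> finite (A \<alpha>)" "\<And>\<alpha>. \<alpha> \<in> S \<Longrightarrow> A \<alpha> \<noteq> {}"
    and \<tau>: "\<And>\<alpha> \<nu>. \<alpha> \<in> S \<Longrightarrow> \<nu> \<in> A \<alpha> \<Longrightarrow>
        (\<lambda>m. monom_val (z m) \<nu> / of_real (monom_size (A \<alpha>) (z m))) \<longlonglongrightarrow> \<tau> \<alpha> \<nu>"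
  shows "\<exists>P w \<kappa> d. strictly_positive P \<and> w \<in> complex_torus \<and>
     (\<forall>\<alpha>\<in>S. \<kappa> \<alpha> \<noteq> 0 \<and> (\<exists>\<nu>\<in>A \<alpha>. \<tau> \<alpha> \<nu> \<noteq> 0) \<and>
        (\<forall>\<nu>\<in>A \<alpha>. if \<tau> \<alpha> \<nu> = 0 then d \<alpha> < P \<bullet> exponent_point \<nu>
                 else P \<bullet> exponent_point \<nu> = d \<alpha> \<and> \<tau> \<alpha> \<nu> = \<kappa> \<alpha> * monom_val w \<nu>))"
proof -
  let ?M = "\<lambda>\<alpha> m. monom_size (A \<alpha>) (z m)"
  have M: "0 < ?M \<alpha> m" if "\<alpha> \<in> S" for \<alpha> m by (rule monom_size_pos[OF A[OF that] z(1)])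
  define x where "x m = (\<chi> i. - ln (norm (z m $ i)))" for m
  define a where "a m = (\<chi> i. sgn (z m $ i))" for m
  have mv: "monom_val (z m) \<nu> = monom_val (a m) \<nu> * of_real (exp (- (x m \<bullet> exponent_point \<nu>)))" for m \<nu>
    by (subst polar_coordinates[OF z(1)], subst monom_val_polar) (simp add: a_def x_def)
  have a1: "norm (monom_val (a m) \<nu>) = 1" for m \<nu>
    using z(1)[of m] by (simp add: norm_monom_val a_def norm_sgn complex_torus_def)
  have norm_mv: "norm (monom_val (z m) \<nu>) = exp (- (x m \<bullet> exponent_point \<nu>))" for m \<nu>
    by (simp add: mv norm_mult a1)
  \<comment> \<open>Each normalised vector of monomials has \<open>l\<^sup>1\<close>-norm one, so some monomial survives in the limit;
    all others of the same function are compared with it.\<close>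
  have "\<exists>\<nu>\<in>A \<alpha>. \<tau> \<alpha> \<nu> \<noteq> 0" if \<alpha>: "\<alpha> \<in> S" for \<alpha>
  proof (rule ccontr)
    assume "\<not> ?thesis"
    then have "(\<lambda>m. \<Sum>\<nu>\<in>A \<alpha>. norm (monom_val (z m) \<nu> / of_real (?M \<alpha> m))) \<longlonglongrightarrow> (\<Sum>\<nu>\<in>A \<alpha>. norm (0::complex))"
      using \<tau>[OF \<alpha>] by (intro tendsto_sum tendsto_norm) auto
    moreover have "(\<Sum>\<nu>\<in>A \<alpha>. norm (monom_val (z m) \<nu> / of_real (?M \<alpha> m))) = 1" for m
    proof -
      have "(\<Sum>\<nu>\<in>A \<alpha>. norm (monom_val (z m) \<nu> / of_real (?M \<alpha> m))) =
            (\<Sum>\<nu>\<in>A \<alpha>. norm (monom_val (z m) \<nu>)) / ?M \<alpha> m"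
        using M[OF \<alpha>, of m] by (simp add: norm_divide sum_divide_distrib)
      then show ?thesis using M[OF \<alpha>, of m] by (simp add: monom_size_def)
    qed
    ultimately show False by (simp add: LIMSEQ_const_iff)
  qed
  then obtain \<mu> where \<mu>: "\<And>\<alpha>. \<alpha> \<in> S \<Longrightarrow> \<mu> \<alpha> \<in> A \<alpha>" "\<And>\<alpha>. \<alpha> \<in> S \<Longrightarrow> \<tau> \<alpha> (\<mu> \<alpha>) \<noteq> 0"
    by metis
  have ratio: "(\<lambda>m. monom_val (z m) \<nu> / monom_val (z m) (\<mu> \<alpha>)) \<longlonglongrightarrow> \<tau> \<alpha> \<nu> / \<tau> \<alpha> (\<mu> \<alpha>)"
    if "\<alpha> \<in> S" "\<nu> \<in> A \<alpha>" for \<alpha> \<nu>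
  proof -
    have lim: "(\<lambda>m. (monom_val (z m) \<nu> / of_real (?M \<alpha> m)) / (monom_val (z m) (\<mu> \<alpha>) / of_real (?M \<alpha> m)))
            \<longlonglongrightarrow> \<tau> \<alpha> \<nu> / \<tau> \<alpha> (\<mu> \<alpha>)"
      by (intro tendsto_divide \<tau> that \<mu>)
    have eq: "(monom_val (z m) \<nu> / of_real (?M \<alpha> m)) / (monom_val (z m) (\<mu> \<alpha>) / of_real (?M \<alpha> m)) =
        monom_val (z m) \<nu> / monom_val (z m) (\<mu> \<alpha>)" for m
      using M[OF that(1), of m] by simp
    show ?thesis using lim unfolding eq .
  qed
  let ?d = "\<lambda>\<alpha> \<nu>. exponent_point \<nu> - exponent_point (\<mu> \<alpha>)"
  have xd: "x m \<bullet> ?d \<alpha> \<nu> = - ln (norm (monom_val (z m) \<nu> / monom_val (z m) (\<mu> \<alpha>)))" for m \<alpha> \<nu>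
    by (simp add: norm_divide norm_mv inner_diff_right flip: exp_diff)
  have conv: "convergent (\<lambda>m. x m \<bullet> ?d \<alpha> \<nu>)" if "\<alpha> \<in> S" "\<nu> \<in> A \<alpha>" "\<tau> \<alpha> \<nu> \<noteq> 0" for \<alpha> \<nu>
  proof -
    have "(\<lambda>m. - ln (norm (monom_val (z m) \<nu> / monom_val (z m) (\<mu> \<alpha>)))) \<longlonglongrightarrow> - ln (norm (\<tau> \<alpha> \<nu> / \<tau> \<alpha> (\<mu> \<alpha>)))"
      by (intro tendsto_intros ratio that) (use that \<mu> in auto)
    then show ?thesis unfolding xd by (auto simp: convergent_def)
  qed
  have neg_ln: "filterlim (\<lambda>m. - ln (norm (q m))) at_top sequentially"
    if "q \<longlonglongrightarrow> 0" "\<And>m. q m \<noteq> 0" for q :: "nat \<Rightarrow> complex"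
  proof -
    have "filterlim (\<lambda>m. norm (q m)) (at_right 0) sequentially"
      using tendsto_norm[OF that(1)] that(2) by (auto simp: filterlim_at eventually_sequentially)
    then have "filterlim (\<lambda>m. ln (norm (q m))) at_bot sequentially"
      by (rule filterlim_compose[OF ln_at_0])
    then show ?thesis by (simp add: filterlim_uminus_at_top)
  qed
  define D where "D = range (\<lambda>i. axis i 1 :: real^'n) \<union>
      (\<Union>\<alpha>\<in>S. ?d \<alpha> ` {\<nu>\<in>A \<alpha>. \<tau> \<alpha> \<nu> = 0})"
  have "finite D" using S A by (auto simp: D_def)
  moreover have "filterlim (\<lambda>m. x m \<bullet> d) at_top sequentially" if "d \<in> D" for d
  proof -
    from that consider i where "d = axis i 1" | \<alpha> \<nu> where "\<alpha> \<in> S" "\<nu> \<in> A \<alpha>" "\<tau> \<alpha> \<nu> = 0" "d = ?d \<alpha> \<nu>"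
      by (auto simp: D_def)
    then show ?thesis
    proof cases
      case 1
      have "(\<lambda>m. z m $ i) \<longlonglongrightarrow> 0" using tendsto_vec_nth[OF z(2), of i] by simp
      from neg_ln[OF this] show ?thesis using z(1) by (simp add: 1 inner_axis x_def complex_torus_def)
    next
      case 2
      have "(\<lambda>m. monom_val (z m) \<nu> / monom_val (z m) (\<mu> \<alpha>)) \<longlonglongrightarrow> 0" using ratio[OF 2(1,2)] 2(3) by simp
      from neg_ln[OF this] show ?thesis using monom_val_nonzero[OF z(1)] unfolding 2(4) xd by simp
    qed
  qed
  ultimately obtain P y where
    conv_d: "\<And>d. convergent (\<lambda>m. x m \<bullet> d) \<Longrightarrow> P \<bullet> d = 0 \<and> (\<lambda>m. x m \<bullet> d) \<longlonglongrightarrow> y \<bullet> d"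
    and pos_d: "\<And>d. d \<in> D \<Longrightarrow> 0 < P \<bullet> d"
    using separating_functional_of_divergent_sequence[of D x] by blast
  define \<Phi> where "\<Phi> = (\<chi> i. \<phi> i)"
  define w where "w = (\<chi> i. \<Phi> $ i * of_real (exp (- (y $ i))))"
  have "norm (\<phi> i) = 1" for i
  proof -
    have "norm (sgn (z m $ i)) = 1" for m using z(1)[of m] by (simp add: norm_sgn complex_torus_def)
    then show ?thesis using tendsto_norm[OF \<phi>[of i]] by (simp add: LIMSEQ_const_iff)
  qed
  then have \<phi>0: "\<phi> i \<noteq> 0" for i by (metis norm_zero zero_neq_one)
  then have \<Phi>: "\<Phi> \<in> complex_torus" and w: "w \<in> complex_torus"
    by (auto simp: complex_torus_def w_def \<Phi>_def)
  have a_lim: "(\<lambda>m. monom_val (a m) \<nu>) \<longlonglongrightarrow> monom_val \<Phi> \<nu>" for \<nu>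
    unfolding monom_val_def a_def \<Phi>_def by (auto intro!: tendsto_intros \<phi>)
  have \<tau>_eq: "\<tau> \<alpha> \<nu> = \<tau> \<alpha> (\<mu> \<alpha>) / monom_val w (\<mu> \<alpha>) * monom_val w \<nu>"
    if that: "\<alpha> \<in> S" "\<nu> \<in> A \<alpha>" "\<tau> \<alpha> \<nu> \<noteq> 0" for \<alpha> \<nu>
  proof -
    have exp_lim: "(\<lambda>m. complex_of_real (exp (- (x m \<bullet> ?d \<alpha> \<nu>)))) \<longlonglongrightarrow> of_real (exp (- (y \<bullet> ?d \<alpha> \<nu>)))"
      using conv_d[OF conv[OF that]] by (intro tendsto_of_real tendsto_exp tendsto_minus) auto
    have "(\<lambda>m. monom_val (a m) \<nu> / monom_val (a m) (\<mu> \<alpha>) * of_real (exp (- (x m \<bullet> ?d \<alpha> \<nu>))))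
       \<longlonglongrightarrow> monom_val \<Phi> \<nu> / monom_val \<Phi> (\<mu> \<alpha>) * of_real (exp (- (y \<bullet> ?d \<alpha> \<nu>)))"
      by (intro tendsto_intros a_lim exp_lim monom_val_nonzero \<Phi>)
    moreover have "monom_val (a m) \<nu> / monom_val (a m) (\<mu> \<alpha>) * of_real (exp (- (x m \<bullet> ?d \<alpha> \<nu>))) =
        monom_val (z m) \<nu> / monom_val (z m) (\<mu> \<alpha>)" for m
      by (simp add: mv inner_diff_right exp_diff exp_minus field_simps)
    moreover have "monom_val \<Phi> \<nu> / monom_val \<Phi> (\<mu> \<alpha>) * of_real (exp (- (y \<bullet> ?d \<alpha> \<nu>))) =
        monom_val w \<nu> / monom_val w (\<mu> \<alpha>)"
      unfolding w_def monom_val_polar by (simp add: inner_diff_right exp_diff exp_minus field_simps)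
    ultimately have "\<tau> \<alpha> \<nu> / \<tau> \<alpha> (\<mu> \<alpha>) = monom_val w \<nu> / monom_val w (\<mu> \<alpha>)"
      using LIMSEQ_unique[OF ratio[OF that(1,2)]] by simp
    then show ?thesis using \<mu>(2)[OF that(1)] monom_val_nonzero[OF w, of "\<mu> \<alpha>"] by (simp add: field_simps)
  qed
  show ?thesis
  proof (intro exI conjI ballI)
    show "strictly_positive P"
      unfolding strictly_positive_def
    proof
      fix i show "0 < P $ i" using pos_d[of "axis i 1"] by (simp add: D_def inner_axis)
    qed
    show "w \<in> complex_torus" by fact
    fix \<alpha> assume \<alpha>: "\<alpha> \<in> S"
    show "\<tau> \<alpha> (\<mu> \<alpha>) / monom_val w (\<mu> \<alpha>) \<noteq> 0" using \<mu>(2)[OF \<alpha>] monom_val_nonzero[OF w] by simp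
    show "\<exists>\<nu>\<in>A \<alpha>. \<tau> \<alpha> \<nu> \<noteq> 0" using \<mu> \<alpha> by blast
    fix \<nu> assume \<nu>: "\<nu> \<in> A \<alpha>"
    show "if \<tau> \<alpha> \<nu> = 0 then P \<bullet> exponent_point (\<mu> \<alpha>) < P \<bullet> exponent_point \<nu>
          else P \<bullet> exponent_point \<nu> = P \<bullet> exponent_point (\<mu> \<alpha>) \<and>
               \<tau> \<alpha> \<nu> = \<tau> \<alpha> (\<mu> \<alpha>) / monom_val w (\<mu> \<alpha>) * monom_val w \<nu>"
    proof (cases "\<tau> \<alpha> \<nu> = 0")
      case True
      then have "?d \<alpha> \<nu> \<in> D" using \<alpha> \<nu> by (auto simp: D_def)
      from pos_d[OF this] True show ?thesis by (simp add: inner_diff_right)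
    next
      case False
      then show ?thesis using conv_d[OF conv[OF \<alpha> \<nu> False]] \<tau>_eq[OF \<alpha> \<nu> False]
        by (simp add: inner_diff_right)
    qed
  qed
qed

section \<open>Non-degeneracy at torus points near the origin\<close>

lemma euler_operator_polynomial:
  fixes c :: "nat^'n \<Rightarrow> complex"
  assumes T: "finite T"
  shows "z $ i * cgrad (\<lambda>z. \<Sum>\<nu>\<in>T. c \<nu> * monom_val z \<nu>) z $ i =
         (\<Sum>\<nu>\<in>T. of_nat (\<nu> $ i) * c \<nu> * monom_val z \<nu>)"
proof -
  define r where "r = norm z + 1"
  have r: "0 < r" using norm_ge_zero[of z] unfolding r_def by linarith
  have "norm (z $ i) < r" for i
    using Finite_Cartesian_Product.norm_nth_le[of z i] unfolding r_def by linarith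
  then have z: "z \<in> polydisc r" by (simp add: polydisc_def)
  define c' where "c' = (\<lambda>\<nu>. if \<nu> \<in> T then c \<nu> else 0)"
  have poly: "(\<lambda>z. \<Sum>\<nu>\<in>T. c \<nu> * monom_val z \<nu>) = (\<lambda>z. \<Sum>\<nu>\<in>T. c' \<nu> * monom_val z \<nu>)"
    by (auto simp: c'_def)
  have "power_series_on r (\<lambda>z. \<Sum>\<nu>\<in>T. c' \<nu> * monom_val z \<nu>) c'"
    by (rule power_series_on_polynomial[OF T r]) (simp add: c'_def)
  from power_series_euler_operator[OF this, of i]
  have 1: "((\<lambda>\<nu>. of_nat (\<nu> $ i) * c' \<nu> * monom_val z \<nu>) has_sum
      z $ i * cgrad (\<lambda>z. \<Sum>\<nu>\<in>T. c' \<nu> * monom_val z \<nu>) z $ i) UNIV"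
    using z by (simp add: power_series_on_def)
  have "power_series_on r (\<lambda>z. \<Sum>\<nu>\<in>T. of_nat (\<nu> $ i) * c' \<nu> * monom_val z \<nu>) (\<lambda>\<nu>. of_nat (\<nu> $ i) * c' \<nu>)"
    by (rule power_series_on_polynomial[OF T r]) (simp add: c'_def)
  then have 2: "((\<lambda>\<nu>. of_nat (\<nu> $ i) * c' \<nu> * monom_val z \<nu>) has_sum
      (\<Sum>\<nu>\<in>T. of_nat (\<nu> $ i) * c' \<nu> * monom_val z \<nu>)) UNIV"
    using z by (simp add: power_series_on_def)
  show ?thesis unfolding poly using has_sum_unique[OF 1 2] by (simp add: c'_def)
qed

lemma cgrad_prod:
  fixes g :: "'a \<Rightarrow> complex^'n \<Rightarrow> complex"
  assumes g: "\<And>\<alpha>. \<alpha> \<in> S \<Longrightarrow> power_series_on r (g \<alpha>) (c \<alpha>)" and z: "z \<in> polydisc r"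
  shows "cgrad (\<lambda>z. \<Prod>\<alpha>\<in>S. g \<alpha> z) z $ i = (\<Sum>\<alpha>\<in>S. cgrad (g \<alpha>) z $ i * (\<Prod>\<beta>\<in>S - {\<alpha>}. g \<beta> z))"
proof -
  let ?p = "\<lambda>w. (\<chi> l. if l = i then w else z $ l) :: complex^'n"
  have pz: "?p (z $ i) = z" by (simp add: vec_eq_iff)
  have "((\<lambda>w. \<Prod>\<alpha>\<in>S. g \<alpha> (?p w)) has_field_derivative
      (\<Sum>\<alpha>\<in>S. cgrad (g \<alpha>) z $ i * (\<Prod>\<beta>\<in>S - {\<alpha>}. g \<beta> (?p (z $ i))))) (at (z $ i))"
    by (rule has_field_derivative_prod) (rule power_series_partial_derivative(1)[OF g z])
  then show ?thesis unfolding pz by (simp add: cgrad_def DERIV_imp_deriv)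
qed

text \<open>Summing the second system against the weights and using Euler's relation gives \<open>(\<Sum>\<alpha>. d \<alpha>) * s = 0\<close>,
  hence \<open>s = 0\<close>. Then \<open>l\<close> vanishes wherever the face function does not, and the rest of the second
  system is a linear relation between gradients at a point of \<open>V\<^sub>I(P)\<^sup>*\<close>, where \<open>I\<close> is the set of the
  \<open>\<alpha>\<close> whose face function vanishes at \<open>w\<close>.\<close>

lemma face_system_only_trivial_solution:
  fixes fs :: "'a \<Rightarrow> complex^'n \<Rightarrow> complex"
  assumes S: "finite S" "S \<noteq> {}" and P: "strictly_positive P" and w: "w \<in> complex_torus"
    and nd: "\<And>I. I \<subseteq> S \<Longrightarrow> nondegenerate_complete_intersection fs I"
    and \<kappa>: "\<And>\<alpha>. \<alpha> \<in> S \<Longrightarrow> \<kappa> \<alpha> \<noteq> 0" and d: "\<And>\<alpha>. \<alpha> \<in> S \<Longrightarrow> 0 < (d \<alpha> :: real)"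
    and euler: "\<And>\<alpha>. \<alpha> \<in> S \<Longrightarrow> (\<Sum>i\<in>UNIV. of_real (P $ i) * (w $ i * cgrad (face_function P (fs \<alpha>)) w $ i)) =
                   of_real (d \<alpha>) * face_function P (fs \<alpha>) w"
    and eq1: "\<And>\<alpha>. \<alpha> \<in> S \<Longrightarrow> l \<alpha> * (\<kappa> \<alpha> * face_function P (fs \<alpha>) w) = s"
    and eq2: "\<And>i. (\<Sum>\<alpha>\<in>S. l \<alpha> * (\<kappa> \<alpha> * (w $ i * cgrad (face_function P (fs \<alpha>)) w $ i))) = 0"
    and \<alpha>: "\<alpha> \<in> S"
  shows "l \<alpha> = 0"
proof -
  let ?F = "\<lambda>\<alpha>. face_function P (fs \<alpha>)"
  have "0 = (\<Sum>i\<in>UNIV. of_real (P $ i) * (\<Sum>\<alpha>\<in>S. l \<alpha> * (\<kappa> \<alpha> * (w $ i * cgrad (?F \<alpha>) w $ i))))"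
    by (simp add: eq2)
  also have "\<dots> = (\<Sum>\<alpha>\<in>S. \<Sum>i\<in>UNIV. of_real (P $ i) * (l \<alpha> * (\<kappa> \<alpha> * (w $ i * cgrad (?F \<alpha>) w $ i))))"
    unfolding sum_distrib_left by (rule sum.swap)
  also have "\<dots> = (\<Sum>\<alpha>\<in>S. l \<alpha> * \<kappa> \<alpha> * (\<Sum>i\<in>UNIV. of_real (P $ i) * (w $ i * cgrad (?F \<alpha>) w $ i)))"
    by (simp add: sum_distrib_left mult_ac)
  also have "\<dots> = (\<Sum>\<alpha>\<in>S. of_real (d \<alpha>) * s)"
  proof (rule sum.cong)
    fix \<alpha> assume \<alpha>: "\<alpha> \<in> S"
    show "l \<alpha> * \<kappa> \<alpha> * (\<Sum>i\<in>UNIV. of_real (P $ i) * (w $ i * cgrad (?F \<alpha>) w $ i)) = of_real (d \<alpha>) * s"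
      unfolding euler[OF \<alpha>] eq1[OF \<alpha>, symmetric] by (simp add: mult_ac)
  qed simp
  also have "\<dots> = of_real (\<Sum>\<alpha>\<in>S. d \<alpha>) * s" by (simp add: sum_distrib_right)
  finally have "of_real (\<Sum>\<alpha>\<in>S. d \<alpha>) * s = 0" by simp
  moreover have "0 < (\<Sum>\<alpha>\<in>S. d \<alpha>)" by (rule sum_pos[OF S d])
  ultimately have "s = 0" by (simp del: of_real_sum)
  define I where "I = {\<alpha> \<in> S. ?F \<alpha> w = 0}"
  have off: "l \<alpha> = 0" if "\<alpha> \<in> S - I" for \<alpha>
    using that eq1[of \<alpha>] \<open>s = 0\<close> \<kappa>[of \<alpha>] by (auto simp: I_def)
  have dep: "(\<Sum>\<alpha>\<in>I. (l \<alpha> * \<kappa> \<alpha>) *s cgrad (?F \<alpha>) w) = 0"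
  proof (subst vec_eq_iff, rule)
    fix i
    have wi: "w $ i \<noteq> 0" using w by (simp add: complex_torus_def)
    have "w $ i * (\<Sum>\<alpha>\<in>I. (l \<alpha> * \<kappa> \<alpha>) * cgrad (?F \<alpha>) w $ i) =
          (\<Sum>\<alpha>\<in>I. l \<alpha> * (\<kappa> \<alpha> * (w $ i * cgrad (?F \<alpha>) w $ i)))"
      by (simp add: sum_distrib_left mult_ac)
    also have "\<dots> = (\<Sum>\<alpha>\<in>S. l \<alpha> * (\<kappa> \<alpha> * (w $ i * cgrad (?F \<alpha>) w $ i)))"
      by (rule sum.mono_neutral_left) (use S off in \<open>auto simp: I_def\<close>)
    finally show "(\<Sum>\<alpha>\<in>I. (l \<alpha> * \<kappa> \<alpha>) *s cgrad (?F \<alpha>) w) $ i = 0 $ i"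
      using eq2[of i] wi by simp
  qed
  have I: "I \<subseteq> S" by (auto simp: I_def)
  have "l \<alpha> * \<kappa> \<alpha> = 0" if "\<alpha> \<in> I"
    by (rule nd[OF I, unfolded nondegenerate_complete_intersection_def, rule_format, OF P w _ dep that])
       (simp add: I_def)
  then show ?thesis using off[of \<alpha>] \<kappa>[OF \<alpha>] \<alpha> by (cases "\<alpha> \<in> I") auto
qed

text \<open>Convenience enters the estimates on the torus through the finite dominating sets \<open>A\<close>.\<close>

locale newton_family =
  fixes S :: "'a set" and fs :: "'a \<Rightarrow> complex^'n \<Rightarrow> complex" and A :: "'a \<Rightarrow> (nat^'n) set" and r :: real
  assumes finS: "finite S" and S_ne: "S \<noteq> {}"
    and series: "\<And>\<alpha>. \<alpha> \<in> S \<Longrightarrow> power_series_on r (fs \<alpha>) (taylor_coeff (fs \<alpha>))"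
    and dom: "\<And>\<alpha>. \<alpha> \<in> S \<Longrightarrow> dominates (A \<alpha>) (taylor_coeff (fs \<alpha>))"
    and supp: "\<And>\<alpha> \<nu>. \<alpha> \<in> S \<Longrightarrow> \<nu> \<in> A \<alpha> \<Longrightarrow> taylor_coeff (fs \<alpha>) \<nu> \<noteq> 0"
    and A_ne: "\<And>\<alpha>. \<alpha> \<in> S \<Longrightarrow> A \<alpha> \<noteq> {}"
    and vanish: "\<And>\<alpha>. \<alpha> \<in> S \<Longrightarrow> fs \<alpha> 0 = 0"
    and nondeg: "\<And>I. I \<subseteq> S \<Longrightarrow> nondegenerate_complete_intersection fs I"
begin

abbreviation M :: "'a \<Rightarrow> complex^'n \<Rightarrow> real" where "M \<alpha> \<equiv> monom_size (A \<alpha>)"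

definition scaled_value :: "'a \<Rightarrow> complex^'n \<Rightarrow> complex" where "scaled_value \<alpha> z = fs \<alpha> z / of_real (M \<alpha> z)"

definition scaled_euler :: "'a \<Rightarrow> 'n \<Rightarrow> complex^'n \<Rightarrow> complex" where
  "scaled_euler \<alpha> i z = z $ i * cgrad (fs \<alpha>) z $ i / of_real (M \<alpha> z)"

definition cofactor_product :: "'a \<Rightarrow> complex^'n \<Rightarrow> complex" where
  "cofactor_product \<alpha> z = (\<Prod>\<beta>\<in>S - {\<alpha>}. scaled_value \<beta> z)"

definition cofactor_size :: "complex^'n \<Rightarrow> real" where
  "cofactor_size z = (\<Sum>\<alpha>\<in>S. norm (cofactor_product \<alpha> z))"

lemma finA: "\<alpha> \<in> S \<Longrightarrow> finite (A \<alpha>)"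
  using dom by (simp add: dominates_def)

lemma M_pos: "\<alpha> \<in> S \<Longrightarrow> z \<in> complex_torus \<Longrightarrow> 0 < M \<alpha> z"
  by (rule monom_size_pos[OF finA A_ne])

lemma r_pos: "0 < r"
  using S_ne series by (auto simp: power_series_on_def)

lemma cofactor_product_times: "\<alpha> \<in> S \<Longrightarrow> cofactor_product \<alpha> z * scaled_value \<alpha> z = (\<Prod>\<beta>\<in>S. scaled_value \<beta> z)"
  unfolding cofactor_product_def using finS by (subst prod.remove[of S \<alpha>]) (auto simp: mult.commute)

text \<open>Translates the limits of normalised monomials into values of the face function and of its
  Euler derivatives at \<open>w\<close>, up to the common factor \<open>\<kappa>\<close>. The last equation is Euler's relation; the weighted
  degree \<open>d\<close> is positive because \<open>f\<^sub>\<alpha>\<close> has no constant term.\<close>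

lemma face_function_of_limits:
  assumes \<alpha>: "\<alpha> \<in> S" and P: "strictly_positive P" and ne: "\<exists>\<nu>\<in>A \<alpha>. \<tau> \<nu> \<noteq> 0"
    and \<tau>: "\<And>\<nu>. \<nu> \<in> A \<alpha> \<Longrightarrow> if \<tau> \<nu> = 0 then d < P \<bullet> exponent_point \<nu>
                 else P \<bullet> exponent_point \<nu> = d \<and> \<tau> \<nu> = \<kappa> * monom_val w \<nu>"
  shows "0 < d"
    and "(\<Sum>\<nu>\<in>A \<alpha>. taylor_coeff (fs \<alpha>) \<nu> * \<tau> \<nu>) = \<kappa> * face_function P (fs \<alpha>) w"
    and "(\<Sum>\<nu>\<in>A \<alpha>. of_nat (\<nu> $ i) * taylor_coeff (fs \<alpha>) \<nu> * \<tau> \<nu>) =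
         \<kappa> * (w $ i * cgrad (face_function P (fs \<alpha>)) w $ i)"
    and "(\<Sum>i\<in>UNIV. of_real (P $ i) * (w $ i * cgrad (face_function P (fs \<alpha>)) w $ i)) =
         of_real d * face_function P (fs \<alpha>) w"
proof -
  define T where "T = {\<nu> \<in> A \<alpha>. \<tau> \<nu> \<noteq> 0}"
  let ?c = "taylor_coeff (fs \<alpha>)"
  have T: "finite T" "T \<noteq> {}" using finA[OF \<alpha>] ne by (auto simp: T_def)
  have eqT: "P \<bullet> exponent_point \<nu> = d" "\<tau> \<nu> = \<kappa> * monom_val w \<nu>" if "\<nu> \<in> T" for \<nu>
    using that \<tau>[of \<nu>] by (auto simp: T_def)
  have Pp: "0 < P $ i" for i using P by (simp add: strictly_positive_def)
  have P_ge: "0 \<le> P \<bullet> exponent_point \<nu>" for \<nu>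
    unfolding inner_vec_def exponent_point_def using Pp by (auto intro!: sum_nonneg simp: less_imp_le)
  have geA: "d \<le> P \<bullet> exponent_point \<nu>" if "\<nu> \<in> A \<alpha>" for \<nu>
    using \<tau>[OF that] by (auto split: if_splits)
  have less: "d < P \<bullet> exponent_point \<nu>" if \<nu>: "?c \<nu> \<noteq> 0" "\<nu> \<notin> T" for \<nu>
  proof (cases "\<nu> \<in> A \<alpha>")
    case True
    then show ?thesis using \<tau>[OF True] \<nu> by (auto simp: T_def)
  next
    case False
    then obtain \<mu> j \<eta> where \<mu>: "\<mu> \<in> A \<alpha>" "\<nu> = \<mu> + axis j 1 + \<eta>"
      using dom[OF \<alpha>] \<nu>(1) by (auto simp: dominates_def)
    have "P \<bullet> exponent_point \<nu> = P \<bullet> exponent_point \<mu> + P $ j + P \<bullet> exponent_point \<eta>"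
      by (simp add: \<mu>(2) exponent_point_add exponent_point_axis inner_add_right inner_axis)
    then show ?thesis using geA[OF \<mu>(1)] Pp[of j] P_ge[of \<eta>] by simp
  qed
  have F: "face_function P (fs \<alpha>) = (\<lambda>z. \<Sum>\<nu>\<in>T. ?c \<nu> * monom_val z \<nu>)"
  proof (rule face_function_eq_sum[OF P T])
    show "?c \<nu> \<noteq> 0" if "\<nu> \<in> T" for \<nu> using that supp[OF \<alpha>] by (simp add: T_def)
  qed (fact eqT(1) less)+
  have E: "w $ i * cgrad (face_function P (fs \<alpha>)) w $ i = (\<Sum>\<nu>\<in>T. of_nat (\<nu> $ i) * ?c \<nu> * monom_val w \<nu>)" for i
    unfolding F by (rule euler_operator_polynomial[OF T(1)])
  have restrict: "(\<Sum>\<nu>\<in>A \<alpha>. b \<nu> * \<tau> \<nu>) = \<kappa> * (\<Sum>\<nu>\<in>T. b \<nu> * monom_val w \<nu>)" for b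
  proof -
    have "(\<Sum>\<nu>\<in>A \<alpha>. b \<nu> * \<tau> \<nu>) = (\<Sum>\<nu>\<in>T. b \<nu> * \<tau> \<nu>)"
      by (rule sum.mono_neutral_right[OF finA[OF \<alpha>]]) (auto simp: T_def)
    also have "\<dots> = \<kappa> * (\<Sum>\<nu>\<in>T. b \<nu> * monom_val w \<nu>)"
      by (simp add: sum_distrib_left eqT(2) mult_ac)
    finally show ?thesis .
  qed
  show "(\<Sum>\<nu>\<in>A \<alpha>. ?c \<nu> * \<tau> \<nu>) = \<kappa> * face_function P (fs \<alpha>) w"
    unfolding F by (rule restrict)
  show "(\<Sum>\<nu>\<in>A \<alpha>. of_nat (\<nu> $ i) * ?c \<nu> * \<tau> \<nu>) =
         \<kappa> * (w $ i * cgrad (face_function P (fs \<alpha>)) w $ i)"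
    unfolding E by (rule restrict)
  show "(\<Sum>i\<in>UNIV. of_real (P $ i) * (w $ i * cgrad (face_function P (fs \<alpha>)) w $ i)) =
         of_real d * face_function P (fs \<alpha>) w"
  proof -
    have "(\<Sum>i\<in>UNIV. of_real (P $ i) * (w $ i * cgrad (face_function P (fs \<alpha>)) w $ i)) =
          (\<Sum>i\<in>UNIV. \<Sum>\<nu>\<in>T. of_real (P $ i) * (of_nat (\<nu> $ i) * ?c \<nu> * monom_val w \<nu>))"
      unfolding E by (simp add: sum_distrib_left)
    also have "\<dots> = (\<Sum>\<nu>\<in>T. \<Sum>i\<in>UNIV. of_real (P $ i) * (of_nat (\<nu> $ i) * ?c \<nu> * monom_val w \<nu>))"
      by (rule sum.swap)
    also have "\<dots> = (\<Sum>\<nu>\<in>T. of_real (P \<bullet> exponent_point \<nu>) * (?c \<nu> * monom_val w \<nu>))"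
    proof (rule sum.cong)
      fix \<nu>
      have "complex_of_real (P \<bullet> exponent_point \<nu>) = (\<Sum>i\<in>UNIV. of_real (P $ i) * of_nat (\<nu> $ i))"
        by (simp add: inner_vec_def exponent_point_def)
      then show "(\<Sum>i\<in>UNIV. of_real (P $ i) * (of_nat (\<nu> $ i) * ?c \<nu> * monom_val w \<nu>)) =
          of_real (P \<bullet> exponent_point \<nu>) * (?c \<nu> * monom_val w \<nu>)"
        by (simp only: sum_distrib_right mult.assoc)
    qed simp
    also have "\<dots> = of_real d * face_function P (fs \<alpha>) w"
      unfolding F by (simp add: eqT(1) sum_distrib_left)
    finally show ?thesis .
  qed
  show "0 < d"
  proof -
    obtain \<nu> where \<nu>: "\<nu> \<in> T" using T(2) by blast
    then have "?c \<nu> \<noteq> 0" using supp[OF \<alpha>] by (auto simp: T_def)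
    then have "\<nu> \<noteq> 0" using power_series_at_0[OF series[OF \<alpha>]] vanish[OF \<alpha>] by auto
    then obtain i where i: "\<nu> $ i \<noteq> 0" by (auto simp: vec_eq_iff)
    have "0 < P \<bullet> exponent_point \<nu>"
      unfolding inner_vec_def exponent_point_def
      by (rule sum_pos2[of _ i]) (use Pp i in \<open>auto simp: less_imp_le\<close>)
    then show ?thesis using eqT(1)[OF \<nu>] by simp
  qed
qed

text \<open>The limiting system has the solution \<open>l\<close> of \<open>l\<^sup>1\<close>-norm one, whereas non-degeneracy admits only the trivial
  solution. The equality of the products \<open>l \<alpha> * (\<kappa> \<alpha> * f\<^sub>\<alpha>\<^sub>P(w))\<close> for different \<open>\<alpha>\<close> comes from
  \<open>\<lambda>\<^sub>\<alpha> u\<^sub>\<alpha> = (\<Prod>\<beta>. u\<^sub>\<beta>)\<close>; working with these products of cofactors in place of \<open>1 / u\<^sub>\<alpha>\<close> covers the zeros of \<open>f\<close> as well.\<close>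

lemma toric_gradient_sequence_contradiction:
  assumes z: "\<And>m. z m \<in> complex_torus" "z \<longlonglongrightarrow> 0"
    and \<phi>: "\<And>i. (\<lambda>m. sgn (z m $ i)) \<longlonglongrightarrow> \<phi> i"
    and \<tau>: "\<And>\<alpha> \<nu>. \<alpha> \<in> S \<Longrightarrow> \<nu> \<in> A \<alpha> \<Longrightarrow> (\<lambda>m. monom_val (z m) \<nu> / of_real (M \<alpha> (z m))) \<longlonglongrightarrow> \<tau> \<alpha> \<nu>"
    and pos: "\<And>m. 0 < cofactor_size (z m)"
    and l: "\<And>\<alpha>. \<alpha> \<in> S \<Longrightarrow> (\<lambda>m. cofactor_product \<alpha> (z m) / of_real (cofactor_size (z m))) \<longlonglongrightarrow> l \<alpha>"
    and small: "\<And>i. (\<lambda>m. (\<Sum>\<alpha>\<in>S. cofactor_product \<alpha> (z m) * scaled_euler \<alpha> i (z m)) / of_real (cofactor_size (z m))) \<longlonglongrightarrow> 0"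
  shows False
proof -
  have "\<exists>P w \<kappa> d. strictly_positive P \<and> w \<in> complex_torus \<and>
     (\<forall>\<alpha>\<in>S. \<kappa> \<alpha> \<noteq> 0 \<and> (\<exists>\<nu>\<in>A \<alpha>. \<tau> \<alpha> \<nu> \<noteq> 0) \<and>
        (\<forall>\<nu>\<in>A \<alpha>. if \<tau> \<alpha> \<nu> = 0 then d \<alpha> < P \<bullet> exponent_point \<nu>
                 else P \<bullet> exponent_point \<nu> = d \<alpha> \<and> \<tau> \<alpha> \<nu> = \<kappa> \<alpha> * monom_val w \<nu>))"
    by (rule monomial_limits_on_face[OF z \<phi> finS finA A_ne \<tau>])
  then obtain P w \<kappa> d where P: "strictly_positive P" and w: "w \<in> complex_torus" and
    all: "\<forall>\<alpha>\<in>S. \<kappa> \<alpha> \<noteq> 0 \<and> (\<exists>\<nu>\<in>A \<alpha>. \<tau> \<alpha> \<nu> \<noteq> 0) \<and>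
        (\<forall>\<nu>\<in>A \<alpha>. if \<tau> \<alpha> \<nu> = 0 then d \<alpha> < P \<bullet> exponent_point \<nu>
                 else P \<bullet> exponent_point \<nu> = d \<alpha> \<and> \<tau> \<alpha> \<nu> = \<kappa> \<alpha> * monom_val w \<nu>)"
    by (elim exE conjE)
  note \<kappa> = all[rule_format, THEN conjunct1] and ne = all[rule_format, THEN conjunct2, THEN conjunct1]
    and face = all[rule_format, THEN conjunct2, THEN conjunct2, rule_format]
  let ?F = "\<lambda>\<alpha>. face_function P (fs \<alpha>)"
  have faces: "0 < d \<alpha>"
      "(\<Sum>\<nu>\<in>A \<alpha>. taylor_coeff (fs \<alpha>) \<nu> * \<tau> \<alpha> \<nu>) = \<kappa> \<alpha> * ?F \<alpha> w"
      "(\<Sum>\<nu>\<in>A \<alpha>. of_nat (\<nu> $ i) * taylor_coeff (fs \<alpha>) \<nu> * \<tau> \<alpha> \<nu>) = \<kappa> \<alpha> * (w $ i * cgrad (?F \<alpha>) w $ i)"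
      "(\<Sum>i\<in>UNIV. of_real (P $ i) * (w $ i * cgrad (?F \<alpha>) w $ i)) = of_real (d \<alpha>) * ?F \<alpha> w"
    if "\<alpha> \<in> S" for \<alpha> i
    by (rule face_function_of_limits[OF that P ne[OF that]], rule face[OF that], assumption)+
  have u_lim: "(\<lambda>m. scaled_value \<alpha> (z m)) \<longlonglongrightarrow> \<kappa> \<alpha> * ?F \<alpha> w" if \<alpha>: "\<alpha> \<in> S" for \<alpha>
    unfolding scaled_value_def faces(2)[OF \<alpha>, symmetric]
    by (rule power_series_over_monom_size_tendsto[OF series dom A_ne z \<tau>]) (use \<alpha> in auto)
  have e_lim: "(\<lambda>m. scaled_euler \<alpha> i (z m)) \<longlonglongrightarrow> \<kappa> \<alpha> * (w $ i * cgrad (?F \<alpha>) w $ i)" if \<alpha>: "\<alpha> \<in> S" for \<alpha> i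
  proof -
    have "dominates (A \<alpha>) (\<lambda>\<nu>. of_nat (\<nu> $ i) * taylor_coeff (fs \<alpha>) \<nu>)"
      using dom[OF \<alpha>] by (auto simp: dominates_def)
    from power_series_over_monom_size_tendsto[OF power_series_euler_operator[OF series[OF \<alpha>]] this A_ne[OF \<alpha>] z \<tau>[OF \<alpha>]]
    show ?thesis unfolding scaled_euler_def faces(3)[OF \<alpha>, symmetric] by simp
  qed
  obtain \<alpha>0 where \<alpha>0: "\<alpha>0 \<in> S" using S_ne by blast
  define s where "s = l \<alpha>0 * (\<kappa> \<alpha>0 * ?F \<alpha>0 w)"
  have s_lim: "(\<lambda>m. (\<Prod>\<beta>\<in>S. scaled_value \<beta> (z m)) / of_real (cofactor_size (z m))) \<longlonglongrightarrow> l \<alpha> * (\<kappa> \<alpha> * ?F \<alpha> w)"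
    if \<alpha>: "\<alpha> \<in> S" for \<alpha>
    using tendsto_mult[OF l[OF \<alpha>] u_lim[OF \<alpha>]] by (simp add: cofactor_product_times[OF \<alpha>, symmetric])
  have eq1: "l \<alpha> * (\<kappa> \<alpha> * ?F \<alpha> w) = s" if \<alpha>: "\<alpha> \<in> S" for \<alpha>
    unfolding s_def by (rule LIMSEQ_unique[OF s_lim[OF \<alpha>] s_lim[OF \<alpha>0]])
  have eq2: "(\<Sum>\<alpha>\<in>S. l \<alpha> * (\<kappa> \<alpha> * (w $ i * cgrad (?F \<alpha>) w $ i))) = 0" for i
  proof -
    have "(\<lambda>m. \<Sum>\<alpha>\<in>S. cofactor_product \<alpha> (z m) / of_real (cofactor_size (z m)) * scaled_euler \<alpha> i (z m))
            \<longlonglongrightarrow> (\<Sum>\<alpha>\<in>S. l \<alpha> * (\<kappa> \<alpha> * (w $ i * cgrad (?F \<alpha>) w $ i)))"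
      by (intro tendsto_sum tendsto_mult l e_lim)
    then show ?thesis using LIMSEQ_unique[OF small[of i]] by (simp add: sum_divide_distrib)
  qed
  have l0: "l \<alpha> = 0" if "\<alpha> \<in> S" for \<alpha>
    by (rule face_system_only_trivial_solution[OF finS S_ne P w nondeg \<kappa> faces(1) faces(4) eq1 eq2 that])
  have "(\<lambda>m. \<Sum>\<alpha>\<in>S. norm (cofactor_product \<alpha> (z m) / of_real (cofactor_size (z m)))) \<longlonglongrightarrow> (\<Sum>\<alpha>\<in>S. norm (l \<alpha>))"
    by (intro tendsto_sum tendsto_norm l)
  moreover have "(\<Sum>\<alpha>\<in>S. norm (cofactor_product \<alpha> (z m) / of_real (cofactor_size (z m)))) = 1" for m
  proof -
    have "(\<Sum>\<alpha>\<in>S. norm (cofactor_product \<alpha> (z m) / of_real (cofactor_size (z m)))) =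
          (\<Sum>\<alpha>\<in>S. norm (cofactor_product \<alpha> (z m))) / cofactor_size (z m)"
      using pos[of m] by (simp add: norm_divide sum_divide_distrib)
    then show ?thesis using pos[of m] by (simp add: cofactor_size_def)
  qed
  ultimately show False using l0 by (simp add: LIMSEQ_const_iff)
qed

lemma toric_gradient_inequality:
  "\<exists>c>0. \<exists>\<rho>>0. \<forall>z\<in>polydisc \<rho> \<inter> complex_torus.
     c * cofactor_size z \<le> (\<Sum>i\<in>UNIV. norm (\<Sum>\<alpha>\<in>S. cofactor_product \<alpha> z * scaled_euler \<alpha> i z))"
proof (rule ccontr)
  let ?G = "\<lambda>z i. \<Sum>\<alpha>\<in>S. cofactor_product \<alpha> z * scaled_euler \<alpha> i z"
  assume contra: "\<not> ?thesis"
  have "\<exists>z\<in>polydisc (1 / real (Suc m)) \<inter> complex_torus. (\<Sum>i\<in>UNIV. norm (?G z i)) < 1 / real (Suc m) * cofactor_size z" for m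
  proof (rule ccontr)
    assume "\<not> ?thesis"
    then have "\<forall>z\<in>polydisc (1 / real (Suc m)) \<inter> complex_torus. 1 / real (Suc m) * cofactor_size z \<le> (\<Sum>i\<in>UNIV. norm (?G z i))"
      by (auto simp: not_less)
    moreover have "0 < 1 / real (Suc m)" by simp
    ultimately show False using contra by blast
  qed
  then have "\<exists>z. \<forall>m. z m \<in> polydisc (1 / real (Suc m)) \<inter> complex_torus \<and>
      (\<Sum>i\<in>UNIV. norm (?G (z m) i)) < 1 / real (Suc m) * cofactor_size (z m)"
    by (intro choice allI) blast
  then obtain z where z': "\<forall>m. z m \<in> polydisc (1 / real (Suc m)) \<inter> complex_torus \<and>
      (\<Sum>i\<in>UNIV. norm (?G (z m) i)) < 1 / real (Suc m) * cofactor_size (z m)" ..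
  have z: "z m \<in> polydisc (1 / real (Suc m))" "z m \<in> complex_torus"
    and zG: "(\<Sum>i\<in>UNIV. norm (?G (z m) i)) < 1 / real (Suc m) * cofactor_size (z m)" for m
    using z'[rule_format, of m] by auto
  have pos: "0 < cofactor_size (z m)" for m
  proof -
    have "0 \<le> (\<Sum>i\<in>UNIV. norm (?G (z m) i))" by (simp add: sum_nonneg)
    then have "0 < 1 / real (Suc m) * cofactor_size (z m)" using zG[of m] by linarith
    then show ?thesis by (simp add: zero_less_divide_iff)
  qed
  have z0: "z \<longlonglongrightarrow> 0"
  proof (rule vec_tendstoI)
    fix i
    have "norm (z m $ i) < 1 / real (Suc m)" for m using z(1)[of m] by (simp add: polydisc_def)
    then have "(\<lambda>m. z m $ i) \<longlonglongrightarrow> 0" by (rule LIMSEQ_norm_0)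
    then show "(\<lambda>m. z m $ i) \<longlonglongrightarrow> 0 $ i" by simp
  qed
  have G0: "(\<lambda>m. ?G (z m) i / of_real (cofactor_size (z m))) \<longlonglongrightarrow> 0" for i
  proof (rule LIMSEQ_norm_0)
    fix m
    have "norm (?G (z m) i) \<le> (\<Sum>i\<in>UNIV. norm (?G (z m) i))" by (rule member_le_sum) auto
    also have "\<dots> < 1 / real (Suc m) * cofactor_size (z m)" by (rule zG)
    finally show "norm (?G (z m) i / of_real (cofactor_size (z m))) < 1 / real (Suc m)"
      using pos[of m] by (simp add: norm_divide divide_less_eq)
  qed
  define X1 where "X1 \<alpha> \<nu> m = monom_val (z m) \<nu> / of_real (M \<alpha> (z m))" for \<alpha> \<nu> m
  define X2 where "X2 \<alpha> m = cofactor_product \<alpha> (z m) / of_real (cofactor_size (z m))" for \<alpha> m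
  define X3 where "X3 i m = sgn (z m $ i)" for i m
  define X where "X = (\<lambda>(\<alpha>, \<nu>). X1 \<alpha> \<nu>) ` (SIGMA \<alpha>:S. A \<alpha>) \<union> X2 ` S \<union> range X3"
  have finX: "finite X" unfolding X_def using finS finA by auto
  have bddX: "bounded (range x)" if "x \<in> X" for x
  proof -
    have "norm (x m) \<le> 1" for m
    proof -
      from that consider \<alpha> \<nu> where "\<alpha> \<in> S" "\<nu> \<in> A \<alpha>" "x = X1 \<alpha> \<nu>" | \<alpha> where "\<alpha> \<in> S" "x = X2 \<alpha>" | i where "x = X3 i"
        by (auto simp: X_def)
      then show ?thesis
      proof cases
        case 1
        then show ?thesis using M_pos[OF 1(1) z(2), of m] monom_size_ge[OF finA[OF 1(1)] 1(2), of "z m"]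
          by (simp add: X1_def norm_divide divide_le_eq)
      next
        case 2
        have "norm (cofactor_product \<alpha> (z m)) \<le> cofactor_size (z m)"
          unfolding cofactor_size_def by (rule member_le_sum) (use 2 finS in auto)
        then show ?thesis using pos[of m] by (simp add: 2 X2_def norm_divide divide_le_eq)
      next
        case 3
        then show ?thesis by (simp add: X3_def norm_sgn)
      qed
    qed
    then show ?thesis by (auto intro: boundedI)
  qed
  obtain q :: "nat \<Rightarrow> nat" where q: "strict_mono q" "\<forall>x\<in>X. convergent (x \<circ> q)"
    using finite_family_convergent_subsequence[OF finX bddX] by blast
  note lims = q(2)[rule_format, unfolded convergent_LIMSEQ_iff]
  show False
  proof (rule toric_gradient_sequence_contradiction[of "z \<circ> q"])
    show "(z \<circ> q) m \<in> complex_torus" "0 < cofactor_size ((z \<circ> q) m)" for m using z(2) pos by auto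
    show "(z \<circ> q) \<longlonglongrightarrow> 0" by (rule LIMSEQ_subseq_LIMSEQ[OF z0 q(1)])
    show "(\<lambda>m. sgn ((z \<circ> q) m $ i)) \<longlonglongrightarrow> lim (X3 i \<circ> q)" for i
      using lims[of "X3 i"] by (simp add: X_def X3_def o_def)
    show "(\<lambda>m. monom_val ((z \<circ> q) m) \<nu> / of_real (M \<alpha> ((z \<circ> q) m))) \<longlonglongrightarrow> lim (X1 \<alpha> \<nu> \<circ> q)"
      if "\<alpha> \<in> S" "\<nu> \<in> A \<alpha>" for \<alpha> \<nu>
    proof -
      have "X1 \<alpha> \<nu> \<in> X" using that by (force simp: X_def)
      from lims[OF this] show ?thesis by (simp add: X1_def o_def)
    qed
    show "(\<lambda>m. cofactor_product \<alpha> ((z \<circ> q) m) / of_real (cofactor_size ((z \<circ> q) m))) \<longlonglongrightarrow> lim (X2 \<alpha> \<circ> q)"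
      if "\<alpha> \<in> S" for \<alpha>
      using lims[of "X2 \<alpha>"] that by (simp add: X_def X2_def o_def)
    show "(\<lambda>m. ?G ((z \<circ> q) m) i / of_real (cofactor_size ((z \<circ> q) m))) \<longlonglongrightarrow> 0" for i
      using LIMSEQ_subseq_LIMSEQ[OF G0 q(1), of i] by (simp add: o_def)
  qed
qed

end

section \<open>The gradient inequality\<close>

text \<open>The product of all cofactors contains each \<open>v \<beta>\<close> exactly \<open>card S - 1\<close> times, and each cofactor is at
  most their sum.\<close>

lemma prod_power_le_sum_cofactors_power:
  fixes v :: "'a \<Rightarrow> real"
  assumes S: "finite S" and v: "\<And>\<alpha>. \<alpha> \<in> S \<Longrightarrow> 0 \<le> v \<alpha>"
  shows "(\<Prod>\<alpha>\<in>S. v \<alpha>) ^ (card S - 1) \<le> (\<Sum>\<alpha>\<in>S. \<Prod>\<beta>\<in>S - {\<alpha>}. v \<beta>) ^ card S"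
proof -
  let ?w = "\<lambda>\<alpha>. \<Prod>\<beta>\<in>S - {\<alpha>}. v \<beta>"
  have w_nonneg: "0 \<le> ?w \<alpha>" for \<alpha> using v by (intro prod_nonneg) auto
  have w: "?w \<alpha> = (\<Prod>\<beta>\<in>S. if \<beta> = \<alpha> then 1 else v \<beta>)" if "\<alpha> \<in> S" for \<alpha>
  proof -
    have "(\<Prod>\<beta>\<in>S. if \<beta> = \<alpha> then 1 else v \<beta>) = (\<Prod>\<beta>\<in>S - {\<alpha>}. if \<beta> = \<alpha> then 1 else v \<beta>)"
      using S that by (subst prod.remove[of S \<alpha>]) auto
    also have "\<dots> = ?w \<alpha>" by (rule prod.cong) auto
    finally show ?thesis ..
  qed
  have "(\<Prod>\<alpha>\<in>S. ?w \<alpha>) = (\<Prod>\<beta>\<in>S. \<Prod>\<alpha>\<in>S. if \<beta> = \<alpha> then 1 else v \<beta>)"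
    by (subst prod.swap) (simp add: w)
  also have "\<dots> = (\<Prod>\<beta>\<in>S. v \<beta> ^ (card S - 1))"
  proof (rule prod.cong)
    fix \<beta> assume \<beta>: "\<beta> \<in> S"
    have "(\<Prod>\<alpha>\<in>S. if \<beta> = \<alpha> then 1 else v \<beta>) = (\<Prod>\<alpha>\<in>S - {\<beta>}. if \<beta> = \<alpha> then 1 else v \<beta>)"
      using S \<beta> by (subst prod.remove[of S \<beta>]) auto
    also have "\<dots> = (\<Prod>\<alpha>\<in>S - {\<beta>}. v \<beta>)" by (rule prod.cong) auto
    also have "\<dots> = v \<beta> ^ (card S - 1)" using S \<beta> by simp
    finally show "(\<Prod>\<alpha>\<in>S. if \<beta> = \<alpha> then 1 else v \<beta>) = v \<beta> ^ (card S - 1)" .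
  qed simp
  also have "\<dots> = (\<Prod>\<alpha>\<in>S. v \<alpha>) ^ (card S - 1)" by (rule prod_power_distrib[symmetric])
  finally have "(\<Prod>\<alpha>\<in>S. v \<alpha>) ^ (card S - 1) = (\<Prod>\<alpha>\<in>S. ?w \<alpha>)" ..
  also have "\<dots> \<le> (\<Prod>\<alpha>\<in>S. \<Sum>\<alpha>\<in>S. ?w \<alpha>)"
  proof (rule prod_mono)
    fix \<alpha> assume \<alpha>: "\<alpha> \<in> S"
    have "?w \<alpha> \<le> (\<Sum>\<alpha>\<in>S. ?w \<alpha>)" by (rule member_le_sum[OF \<alpha>]) (use S w_nonneg in auto)
    then show "0 \<le> ?w \<alpha> \<and> ?w \<alpha> \<le> (\<Sum>\<alpha>\<in>S. ?w \<alpha>)" using w_nonneg by simp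
  qed
  finally show ?thesis by simp
qed

text \<open>The elementary combination of the estimates: \<open>D\<close> is the norm of the gradient, \<open>N\<close> that of the
  point, \<open>m\<close> the product of the monomial sizes, \<open>L\<close> the sum of the cofactors, and \<open>U\<close> the product of
  the scaled values, so that \<open>U * m = \<bar>f\<bar>\<close>. Integer powers avoid a separate treatment of
  \<open>f = 0\<close> and of the exponent \<open>0\<close> when \<open>B = 1\<close>.\<close>

lemma gradient_power_bound:
  fixes c C D L m n N U :: real and B k :: nat
  assumes nonneg: "0 \<le> c" "0 \<le> C" "0 \<le> D" "0 \<le> L" "0 \<le> n" "0 \<le> N" "0 \<le> U" and m: "0 < m"
    and k: "1 \<le> k" "k \<le> B"
    and h1: "c * L * m \<le> n * N * D" and h2: "N ^ B \<le> n ^ B * m"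
    and h3: "U ^ (k - 1) \<le> L ^ k" and h4: "U \<le> C * L"
  shows "c ^ B * (U * m) ^ (B - 1) \<le> C ^ (B - k) * (n ^ B) ^ 2 * D ^ B"
proof -
  have "m ^ B = m ^ (B - 1) * m" using k power_Suc2[of m "B - 1"] by simp
  then have "c ^ B * L ^ B * m ^ (B - 1) * m = (c * L * m) ^ B"
    by (simp add: power_mult_distrib)
  also have "\<dots> \<le> (n * N * D) ^ B"
    by (rule power_mono[OF h1]) (use nonneg m in simp)
  also have "\<dots> = n ^ B * D ^ B * N ^ B" by (simp add: power_mult_distrib mult_ac)
  also have "\<dots> \<le> n ^ B * D ^ B * (n ^ B * m)"
    by (rule mult_left_mono[OF h2]) (use nonneg in simp)
  also have "\<dots> = (n ^ B) ^ 2 * D ^ B * m" by (simp add: power2_eq_square mult_ac)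
  finally have 1: "c ^ B * L ^ B * m ^ (B - 1) \<le> (n ^ B) ^ 2 * D ^ B" using m by simp
  have "U ^ (B - 1) = U ^ (k - 1) * U ^ (B - k)" using k by (simp flip: power_add)
  also have "\<dots> \<le> L ^ k * (C * L) ^ (B - k)"
    by (intro mult_mono h3 power_mono h4) (use nonneg in auto)
  also have "\<dots> = C ^ (B - k) * (L ^ k * L ^ (B - k))" by (simp add: power_mult_distrib mult_ac)
  also have "L ^ k * L ^ (B - k) = L ^ B" using k by (simp flip: power_add)
  finally have 2: "U ^ (B - 1) \<le> C ^ (B - k) * L ^ B" .
  have "c ^ B * (U * m) ^ (B - 1) = U ^ (B - 1) * (c ^ B * m ^ (B - 1))"
    by (simp add: power_mult_distrib mult_ac)
  also have "\<dots> \<le> C ^ (B - k) * L ^ B * (c ^ B * m ^ (B - 1))"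
    by (rule mult_right_mono[OF 2]) (use nonneg m in simp)
  also have "\<dots> = C ^ (B - k) * (c ^ B * L ^ B * m ^ (B - 1))" by (simp add: mult_ac)
  also have "\<dots> \<le> C ^ (B - k) * ((n ^ B) ^ 2 * D ^ B)"
    by (rule mult_left_mono[OF 1]) (use nonneg in simp)
  finally show ?thesis by (simp add: mult_ac)
qed

lemma eventually_in_polydisc: "0 < \<rho> \<Longrightarrow> \<forall>\<^sub>F z in nhds 0. z \<in> polydisc \<rho>"
  by (rule eventually_nhds_in_open[OF open_polydisc zero_in_polydisc])

lemma eventually_norm_le: "\<forall>\<^sub>F z in nhds (0::'a::real_normed_vector). norm z \<le> 1"
proof -
  have "\<forall>\<^sub>F z in nhds (0::'a). z \<in> ball 0 1" by (rule eventually_nhds_in_open) auto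
  then show ?thesis by (rule eventually_mono) auto
qed

lemma approximate_from_torus:
  fixes z :: "complex^'n"
  obtains q where "\<And>m. q m \<in> complex_torus" "q \<longlonglongrightarrow> z"
proof
  let ?q = "\<lambda>m. (\<chi> i. if z $ i = 0 then of_real (1 / real (Suc m)) else z $ i) :: complex^'n"
  show "?q m \<in> complex_torus" for m by (simp add: complex_torus_def del: of_nat_Suc)
  show "?q \<longlonglongrightarrow> z"
  proof (rule vec_tendstoI)
    fix i
    have "(\<lambda>m. complex_of_real (1 / real (Suc m))) \<longlonglongrightarrow> of_real 0"
      by (intro tendsto_of_real) (use LIMSEQ_inverse_real_of_nat in \<open>simp add: inverse_eq_divide\<close>)
    then show "(\<lambda>m. ?q m $ i) \<longlonglongrightarrow> z $ i" by (cases "z $ i = 0") auto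
  qed
qed

lemma power_series_gradient_continuous:
  assumes "power_series_on r h c" shows "continuous_on (polydisc r) (cgrad h)"
proof -
  have "continuous_on (polydisc r) (\<lambda>z. \<chi> i. cgrad h z $ i)"
    by (intro continuous_on_vec_lambda) (rule power_series_continuous[OF power_series_gradient[OF assms]])
  then show ?thesis by simp
qed

context newton_family
begin

lemma scaled_value_bounded: "\<exists>C\<ge>0. \<forall>\<^sub>F z in nhds 0. z \<in> complex_torus \<longrightarrow> (\<forall>\<alpha>\<in>S. norm (scaled_value \<alpha> z) \<le> C)"
proof -
  have "\<exists>C. \<forall>\<^sub>F z in nhds 0. z \<in> complex_torus \<longrightarrow> norm (scaled_value \<alpha> z) \<le> C" if \<alpha>: "\<alpha> \<in> S" for \<alpha>
  proof -
    let ?c = "taylor_coeff (fs \<alpha>)"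
    obtain \<rho> C where \<rho>: "0 < \<rho>" and C: "\<forall>z\<in>polydisc \<rho>.
        norm (fs \<alpha> z - (\<Sum>\<nu>\<in>A \<alpha>. ?c \<nu> * monom_val z \<nu>)) \<le> C * norm z * M \<alpha> z"
      using power_series_remainder[OF series[OF \<alpha>] dom[OF \<alpha>]] by blast
    have bound: "norm (scaled_value \<alpha> z) \<le> (\<Sum>\<nu>\<in>A \<alpha>. norm (?c \<nu>)) + \<bar>C\<bar>"
      if z: "z \<in> polydisc \<rho>" "norm z \<le> 1" "z \<in> complex_torus" for z
    proof -
      have Mz: "0 < M \<alpha> z" by (rule M_pos[OF \<alpha> z(3)])
      have "norm (\<Sum>\<nu>\<in>A \<alpha>. ?c \<nu> * monom_val z \<nu>) \<le> (\<Sum>\<nu>\<in>A \<alpha>. norm (?c \<nu>) * M \<alpha> z)"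
        by (rule sum_norm_le) (auto simp: norm_mult intro!: mult_left_mono monom_size_ge finA[OF \<alpha>])
      also have "\<dots> = (\<Sum>\<nu>\<in>A \<alpha>. norm (?c \<nu>)) * M \<alpha> z" by (simp add: sum_distrib_right)
      finally have 1: "norm (\<Sum>\<nu>\<in>A \<alpha>. ?c \<nu> * monom_val z \<nu>) \<le> (\<Sum>\<nu>\<in>A \<alpha>. norm (?c \<nu>)) * M \<alpha> z" .
      have "C * norm z \<le> \<bar>C\<bar> * norm z" by (rule mult_right_mono) auto
      also have "\<dots> \<le> \<bar>C\<bar> * 1" by (rule mult_left_mono) (use z in auto)
      finally have "C * norm z * M \<alpha> z \<le> \<bar>C\<bar> * M \<alpha> z" using Mz by (simp add: mult_right_mono)
      then have "norm (fs \<alpha> z) \<le> ((\<Sum>\<nu>\<in>A \<alpha>. norm (?c \<nu>)) + \<bar>C\<bar>) * M \<alpha> z"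
        using bspec[OF C z(1)] 1
          norm_triangle_ineq[of "fs \<alpha> z - (\<Sum>\<nu>\<in>A \<alpha>. ?c \<nu> * monom_val z \<nu>)" "\<Sum>\<nu>\<in>A \<alpha>. ?c \<nu> * monom_val z \<nu>"]
        by (simp add: distrib_right)
      then show ?thesis using Mz by (simp add: scaled_value_def norm_divide divide_le_eq)
    qed
    have "\<forall>\<^sub>F z in nhds 0. z \<in> complex_torus \<longrightarrow> norm (scaled_value \<alpha> z) \<le> (\<Sum>\<nu>\<in>A \<alpha>. norm (?c \<nu>)) + \<bar>C\<bar>"
      using eventually_in_polydisc[OF \<rho>] eventually_norm_le
      by eventually_elim (use bound in blast)
    then show ?thesis by blast
  qed
  then obtain C where C: "\<And>\<alpha>. \<alpha> \<in> S \<Longrightarrow> \<forall>\<^sub>F z in nhds 0. z \<in> complex_torus \<longrightarrow> norm (scaled_value \<alpha> z) \<le> C \<alpha>"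
    by metis
  have le: "C \<alpha> \<le> (\<Sum>\<alpha>\<in>S. \<bar>C \<alpha>\<bar>)" if "\<alpha> \<in> S" for \<alpha>
    using member_le_sum[OF that, of "\<lambda>\<alpha>. \<bar>C \<alpha>\<bar>"] finS by auto
  have "\<forall>\<^sub>F z in nhds 0. \<forall>\<alpha>\<in>S. z \<in> complex_torus \<longrightarrow> norm (scaled_value \<alpha> z) \<le> C \<alpha>"
    by (rule eventually_ball_finite[OF finS]) (use C in blast)
  then have "\<forall>\<^sub>F z in nhds 0. z \<in> complex_torus \<longrightarrow> (\<forall>\<alpha>\<in>S. norm (scaled_value \<alpha> z) \<le> (\<Sum>\<alpha>\<in>S. \<bar>C \<alpha>\<bar>))"
    by (rule eventually_mono) (use le order_trans in blast)
  then show ?thesis by (intro exI[of _ "\<Sum>\<alpha>\<in>S. \<bar>C \<alpha>\<bar>"]) (auto intro: sum_nonneg)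
qed

lemma product_gradient:
  assumes z: "z \<in> polydisc r" "z \<in> complex_torus"
  shows "z $ i * cgrad (\<lambda>z. \<Prod>\<alpha>\<in>S. fs \<alpha> z) z $ i =
         of_real (\<Prod>\<alpha>\<in>S. M \<alpha> z) * (\<Sum>\<alpha>\<in>S. cofactor_product \<alpha> z * scaled_euler \<alpha> i z)"
proof -
  have M: "complex_of_real (M \<alpha> z) \<noteq> 0" if "\<alpha> \<in> S" for \<alpha> using M_pos[OF that z(2)] by simp
  have "z $ i * (cgrad (fs \<alpha>) z $ i * (\<Prod>\<beta>\<in>S - {\<alpha>}. fs \<beta> z)) =
        of_real (\<Prod>\<alpha>\<in>S. M \<alpha> z) * (cofactor_product \<alpha> z * scaled_euler \<alpha> i z)" if \<alpha>: "\<alpha> \<in> S" for \<alpha>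
  proof -
    have "(\<Prod>\<beta>\<in>S - {\<alpha>}. fs \<beta> z) = (\<Prod>\<beta>\<in>S - {\<alpha>}. of_real (M \<beta> z) * scaled_value \<beta> z)"
      by (rule prod.cong) (use M in \<open>auto simp: scaled_value_def\<close>)
    also have "\<dots> = of_real (\<Prod>\<beta>\<in>S - {\<alpha>}. M \<beta> z) * cofactor_product \<alpha> z"
      by (simp add: prod.distrib cofactor_product_def)
    finally have 1: "(\<Prod>\<beta>\<in>S - {\<alpha>}. fs \<beta> z) = of_real (\<Prod>\<beta>\<in>S - {\<alpha>}. M \<beta> z) * cofactor_product \<alpha> z" .
    have 2: "(\<Prod>\<alpha>\<in>S. M \<alpha> z) = M \<alpha> z * (\<Prod>\<beta>\<in>S - {\<alpha>}. M \<beta> z)"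
      by (rule prod.remove[OF finS \<alpha>])
    have 3: "z $ i * cgrad (fs \<alpha>) z $ i = of_real (M \<alpha> z) * scaled_euler \<alpha> i z"
      using M[OF \<alpha>] by (simp add: scaled_euler_def)
    have "z $ i * (cgrad (fs \<alpha>) z $ i * (\<Prod>\<beta>\<in>S - {\<alpha>}. fs \<beta> z)) =
          (z $ i * cgrad (fs \<alpha>) z $ i) * (\<Prod>\<beta>\<in>S - {\<alpha>}. fs \<beta> z)" by (simp add: mult_ac)
    then show ?thesis unfolding 1 2 3 by (simp add: mult_ac)
  qed
  moreover have "cgrad (\<lambda>z. \<Prod>\<alpha>\<in>S. fs \<alpha> z) z $ i =
      (\<Sum>\<alpha>\<in>S. cgrad (fs \<alpha>) z $ i * (\<Prod>\<beta>\<in>S - {\<alpha>}. fs \<beta> z))"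
    by (rule cgrad_prod[where c = "\<lambda>\<alpha>. taylor_coeff (fs \<alpha>)" and r = r]) (use series z in auto)
  ultimately show ?thesis by (simp only: sum_distrib_left cong: sum.cong)
qed

text \<open>For the largest coordinate \<open>z\<^sub>j\<close>, the pure powers of \<open>z\<^sub>j\<close> alone already give the bound.\<close>

lemma axis_monomial_bound:
  fixes z :: "complex^'n"
  assumes b: "\<And>\<alpha> j. \<alpha> \<in> S \<Longrightarrow> axis j (b \<alpha> j) \<in> A \<alpha>" and B: "\<And>j. (\<Sum>\<alpha>\<in>S. b \<alpha> j) \<le> B"
    and z: "norm z \<le> 1"
  shows "norm z ^ B \<le> real CARD('n) ^ B * (\<Prod>\<alpha>\<in>S. M \<alpha> z)"
proof -
  obtain j where j: "\<And>i. norm (z $ i) \<le> norm (z $ j)"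
  proof -
    have "Max (range (\<lambda>i. norm (z $ i))) \<in> range (\<lambda>i. norm (z $ i))" by (rule Max_in) auto
    then obtain j where "Max (range (\<lambda>i. norm (z $ i))) = norm (z $ j)" by (rule imageE)
    then show ?thesis using that by (metis Max_ge finite finite_imageI rangeI)
  qed
  have "norm z \<le> (\<Sum>i\<in>UNIV. norm (z $ i))" unfolding norm_vec_def by (rule L2_set_le_sum) auto
  also have "\<dots> \<le> (\<Sum>i\<in>(UNIV::'n set). norm (z $ j))" by (rule sum_mono) (rule j)
  finally have "norm z \<le> real CARD('n) * norm (z $ j)" by simp
  then have "norm z ^ B \<le> (real CARD('n) * norm (z $ j)) ^ B" by (rule power_mono) simp
  also have "\<dots> = real CARD('n) ^ B * norm (z $ j) ^ B" by (rule power_mult_distrib)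
  also have "norm (z $ j) ^ B \<le> norm (z $ j) ^ (\<Sum>\<alpha>\<in>S. b \<alpha> j)"
    by (rule power_decreasing[OF B]) (use z Finite_Cartesian_Product.norm_nth_le[of z j] in auto)
  also have "\<dots> = (\<Prod>\<alpha>\<in>S. norm (monom_val z (axis j (b \<alpha> j))))"
    by (simp add: power_sum monom_val_axis norm_power)
  also have "\<dots> \<le> (\<Prod>\<alpha>\<in>S. M \<alpha> z)"
    by (rule prod_mono) (auto intro!: monom_size_ge finA b)
  finally show ?thesis by (simp add: mult_left_mono)
qed

lemma card_le_axis_exponent_sum:
  assumes b: "\<And>\<alpha>. \<alpha> \<in> S \<Longrightarrow> axis j (b \<alpha>) \<in> A \<alpha>"
  shows "card S \<le> (\<Sum>\<alpha>\<in>S. b \<alpha>)"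
proof -
  have "1 \<le> b \<alpha>" if \<alpha>: "\<alpha> \<in> S" for \<alpha>
  proof -
    have "taylor_coeff (fs \<alpha>) 0 = 0" using power_series_at_0[OF series[OF \<alpha>]] vanish[OF \<alpha>] by simp
    moreover have "axis j 0 = (0 :: nat^'n)" by (simp add: axis_def vec_eq_iff)
    ultimately have "b \<alpha> \<noteq> 0" using supp[OF \<alpha> b[OF \<alpha>]] by metis
    then show ?thesis by simp
  qed
  then have "(\<Sum>\<alpha>\<in>S. 1) \<le> (\<Sum>\<alpha>\<in>S. b \<alpha>)" by (intro sum_mono)
  then show ?thesis by simp
qed

text \<open>On the torus this combines the toric inequality with the bound of \<open>\<parallel>z\<parallel>\<close> by the pure powers. The torus is
  dense and both sides are continuous, so the estimate persists on the coordinate hyperplanes.\<close>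

lemma gradient_inequality:
  fixes b :: "'a \<Rightarrow> 'n \<Rightarrow> nat"
  assumes b: "\<And>\<alpha> j. \<alpha> \<in> S \<Longrightarrow> axis j (b \<alpha> j) \<in> A \<alpha>" and B: "\<And>j. (\<Sum>\<alpha>\<in>S. b \<alpha> j) \<le> B"
  defines "f \<equiv> \<lambda>z. \<Prod>\<alpha>\<in>S. fs \<alpha> z"
  shows "\<exists>K>0. \<forall>\<^sub>F z in nhds 0. K * norm (f z) ^ (B - 1) \<le> norm (cgrad f z) ^ B"
proof -
  let ?n = "real CARD('n)"
  let ?k = "card S"
  have k1: "1 \<le> ?k" using finS S_ne by (simp add: Suc_leI card_gt_0_iff)
  have kB: "?k \<le> B"
    using card_le_axis_exponent_sum[OF b, of undefined] B[of undefined] by simp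
  obtain c \<rho> where c: "0 < c" and \<rho>: "0 < \<rho>" and tor: "\<forall>z\<in>polydisc \<rho> \<inter> complex_torus.
      c * cofactor_size z \<le> (\<Sum>i\<in>UNIV. norm (\<Sum>\<alpha>\<in>S. cofactor_product \<alpha> z * scaled_euler \<alpha> i z))"
    using toric_gradient_inequality by blast
  obtain C where C: "0 \<le> C" and ub: "\<forall>\<^sub>F z in nhds 0. z \<in> complex_torus \<longrightarrow> (\<forall>\<alpha>\<in>S. norm (scaled_value \<alpha> z) \<le> C)"
    using scaled_value_bounded by blast
  \<comment> \<open>The summand \<open>1\<close> keeps the constant positive when \<open>C = 0\<close>.\<close>
  define K0 where "K0 = C ^ (B - ?k) * (?n ^ B) ^ 2 + 1"
  have K0: "0 < K0" using C by (auto simp: K0_def intro: add_nonneg_pos)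
  have on_torus: "c ^ B / K0 * norm (f z) ^ (B - 1) \<le> norm (cgrad f z) ^ B"
    if z: "z \<in> polydisc r" "z \<in> polydisc \<rho>" "norm z \<le> 1" "z \<in> complex_torus" and uC: "\<And>\<alpha>. \<alpha> \<in> S \<Longrightarrow> norm (scaled_value \<alpha> z) \<le> C" for z
  proof -
    let ?m = "\<Prod>\<alpha>\<in>S. M \<alpha> z"
    let ?U = "\<Prod>\<alpha>\<in>S. norm (scaled_value \<alpha> z)"
    let ?D = "norm (cgrad f z)"
    have m: "0 < ?m" by (rule prod_pos) (use M_pos z in auto)
    have L: "0 \<le> cofactor_size z" by (simp add: cofactor_size_def sum_nonneg)
    have "c * cofactor_size z * ?m \<le> (\<Sum>i\<in>UNIV. norm (\<Sum>\<alpha>\<in>S. cofactor_product \<alpha> z * scaled_euler \<alpha> i z)) * ?m"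
      by (rule mult_right_mono) (use tor z m in auto)
    also have "\<dots> = (\<Sum>i\<in>UNIV. norm (z $ i * cgrad f z $ i))"
      unfolding f_def product_gradient[OF z(1,4)] norm_mult norm_of_real abs_of_pos[OF m]
      by (simp only: sum_distrib_left sum_distrib_right mult.commute)
    also have "\<dots> \<le> (\<Sum>i\<in>(UNIV::'n set). norm z * ?D)"
      unfolding norm_mult by (intro sum_mono mult_mono Finite_Cartesian_Product.norm_nth_le) auto
    finally have h1: "c * cofactor_size z * ?m \<le> ?n * norm z * ?D" by (simp add: mult_ac)
    have h2: "norm z ^ B \<le> ?n ^ B * ?m" by (rule axis_monomial_bound[OF b B z(3)])
    have h3: "?U ^ (?k - 1) \<le> cofactor_size z ^ ?k"
      unfolding cofactor_size_def cofactor_product_def prod_norm[symmetric]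
      by (rule prod_power_le_sum_cofactors_power[OF finS]) simp
    have h4: "?U \<le> C * cofactor_size z"
    proof -
      obtain \<alpha> where \<alpha>: "\<alpha> \<in> S" using S_ne by blast
      have "?U = norm (scaled_value \<alpha> z) * norm (cofactor_product \<alpha> z)"
        unfolding prod_norm cofactor_product_times[OF \<alpha>, symmetric] by (simp add: norm_mult)
      also have "norm (cofactor_product \<alpha> z) \<le> cofactor_size z"
        unfolding cofactor_size_def by (rule member_le_sum[OF \<alpha>]) (use finS in auto)
      also have "norm (scaled_value \<alpha> z) * cofactor_size z \<le> C * cofactor_size z"
        by (rule mult_right_mono[OF uC[OF \<alpha>] L])
      finally show ?thesis by (simp add: mult_left_mono)
    qed
    have "norm (f z) = ?U * ?m"
    proof -
      have "norm (fs \<alpha> z) = norm (scaled_value \<alpha> z) * M \<alpha> z" if "\<alpha> \<in> S" for \<alpha>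
        using M_pos[OF that z(4)] by (simp add: scaled_value_def norm_divide)
      then show ?thesis by (simp add: f_def prod_norm[symmetric] prod.distrib)
    qed
    then have "c ^ B * norm (f z) ^ (B - 1) \<le> C ^ (B - ?k) * (?n ^ B) ^ 2 * ?D ^ B"
      using gradient_power_bound[OF _ C _ L _ _ _ m k1 kB h1 h2 h3 h4] c by (simp add: prod_nonneg)
    also have "\<dots> \<le> K0 * ?D ^ B" unfolding K0_def by (rule mult_right_mono) auto
    finally show ?thesis using K0 by (simp add: divide_le_eq pos_divide_le_eq field_simps)
  qed
  have "\<forall>\<^sub>F z in nhds 0. z \<in> complex_torus \<longrightarrow> c ^ B / K0 * norm (f z) ^ (B - 1) \<le> norm (cgrad f z) ^ B"
    using ub eventually_in_polydisc[OF \<rho>] eventually_in_polydisc[OF r_pos] eventually_norm_le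
    by eventually_elim (use on_torus in blast)
  then obtain V where V: "open V" "0 \<in> V"
    "\<And>z. z \<in> V \<Longrightarrow> z \<in> complex_torus \<Longrightarrow> c ^ B / K0 * norm (f z) ^ (B - 1) \<le> norm (cgrad f z) ^ B"
    unfolding eventually_nhds by blast
  obtain cf where cf: "power_series_on r f cf"
    using power_series_on_prod[OF finS r_pos, of fs] series unfolding f_def by blast
  have "c ^ B / K0 * norm (f z) ^ (B - 1) \<le> norm (cgrad f z) ^ B" if z: "z \<in> V" "z \<in> polydisc r" for z
  proof -
    obtain q where q: "\<And>m. q m \<in> complex_torus" "q \<longlonglongrightarrow> z" using approximate_from_torus[of z] by blast
    have "isCont f z" "isCont (cgrad f) z"
      using power_series_continuous[OF cf] power_series_gradient_continuous[OF cf] z(2)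
        continuous_on_eq_continuous_at[OF open_polydisc] by blast+
    then have lim: "(\<lambda>m. f (q m)) \<longlonglongrightarrow> f z" "(\<lambda>m. cgrad f (q m)) \<longlonglongrightarrow> cgrad f z"
      using q(2) isCont_tendsto_compose by blast+
    have "\<forall>\<^sub>F m in sequentially. q m \<in> V" by (rule topological_tendstoD[OF q(2) V(1) z(1)])
    then have "\<forall>\<^sub>F m in sequentially. c ^ B / K0 * norm (f (q m)) ^ (B - 1) \<le> norm (cgrad f (q m)) ^ B"
      by (rule eventually_mono) (use V(3) q(1) in blast)
    then show ?thesis
      by (rule tendsto_le[OF sequentially_bot, rotated 2])
         (intro tendsto_norm tendsto_power tendsto_mult tendsto_const lim)+
  qed
  moreover have "\<forall>\<^sub>F z in nhds 0. z \<in> V" by (rule eventually_nhds_in_open) fact+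
  ultimately have "\<forall>\<^sub>F z in nhds 0. c ^ B / K0 * norm (f z) ^ (B - 1) \<le> norm (cgrad f z) ^ B"
    using eventually_in_polydisc[OF r_pos] by (auto elim: eventually_elim2)
  then show ?thesis using c K0 by (intro exI[of _ "c ^ B / K0"]) auto
qed

end

lemma lojasiewicz_admissible_of_power_inequality:
  assumes K: "0 < K" and B: "1 \<le> B"
    and ev: "\<forall>\<^sub>F z in nhds 0. K * norm (f z) ^ (B - 1) \<le> norm (cgrad f z) ^ B"
  shows "lojasiewicz_admissible f (1 - 1 / real B)"
proof -
  let ?\<theta> = "1 - 1 / real B"
  let ?c = "K powr (1 / real B)"
  obtain V where V: "open V" "0 \<in> V" "\<And>z. z \<in> V \<Longrightarrow> K * norm (f z) ^ (B - 1) \<le> norm (cgrad f z) ^ B"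
    using ev unfolding eventually_nhds by blast
  have root: "x = (x ^ B) powr (1 / real B)" if "0 \<le> x" for x :: real
    using that B by (cases "x = 0") (auto simp: powr_powr simp flip: powr_realpow)
  have "?c * (if ?\<theta> = 0 then 1 else norm (f z) powr ?\<theta>) \<le> norm (cgrad f z)" if z: "z \<in> V" for z
  proof -
    \<comment> \<open>For \<open>B = 1\<close> both sides are \<open>1\<close>, also where \<open>f\<close> vanishes, because \<open>0 ^ 0 = 1\<close>.\<close>
    have "(if ?\<theta> = 0 then 1 else norm (f z) powr ?\<theta>) = (norm (f z) ^ (B - 1)) powr (1 / real B)"
    proof (cases "B = 1 \<or> f z = 0")
      case True
      then show ?thesis using B by (auto simp: power_0_left)
    next
      case False
      then have "?\<theta> = real (B - 1) * (1 / real B)" using B by (simp add: field_simps of_nat_diff)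
      moreover have "norm (f z) ^ (B - 1) = norm (f z) powr real (B - 1)" using False by (simp add: powr_realpow)
      ultimately show ?thesis using False B by (simp add: powr_powr)
    qed
    then have "?c * (if ?\<theta> = 0 then 1 else norm (f z) powr ?\<theta>) = (K * norm (f z) ^ (B - 1)) powr (1 / real B)"
      using K by (simp add: powr_mult)
    also have "\<dots> \<le> (norm (cgrad f z) ^ B) powr (1 / real B)"
      by (rule powr_mono2) (use V(3)[OF z] K in auto)
    also have "\<dots> = norm (cgrad f z)" by (rule root[symmetric]) simp
    finally show ?thesis .
  qed
  moreover have "0 \<le> ?\<theta>" "?\<theta> < 1" using B by auto
  moreover have "0 < ?c" using K by simp
  ultimately show ?thesis unfolding lojasiewicz_admissible_def using V(1,2) by blast
qed

section \<open>Sharpness along a coordinate axis\<close>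

definition axis_fps :: "(nat^'n \<Rightarrow> complex) \<Rightarrow> 'n \<Rightarrow> complex fps" where
  "axis_fps c j = Abs_fps (\<lambda>m. c (axis j m))"

lemma axis_fps_expansion:
  fixes h :: "complex^'n \<Rightarrow> complex"
  assumes h: "power_series_on r h c"
  shows "(\<lambda>t. h (axis j t)) has_fps_expansion axis_fps c j"
proof (rule has_fps_expansionI)
  have r: "0 < r" using h by (simp add: power_series_on_def)
  have "(\<lambda>m. fps_nth (axis_fps c j) m * t ^ m) sums h (axis j t)" if t: "norm t < r" for t
  proof -
    have "axis j t \<in> polydisc r" using t r by (auto simp: polydisc_def axis_def)
    then have "((\<lambda>\<nu>. c \<nu> * monom_val (axis j t) \<nu>) has_sum h (axis j t)) UNIV"
      using h by (simp add: power_series_on_def)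
    moreover have "monom_val (axis j t) \<nu> = 0" if "\<nu> \<notin> range (axis j)" for \<nu>
    proof -
      have "\<nu> \<noteq> axis j (\<nu> $ j)" using that by (metis rangeI)
      then obtain i where "\<nu> $ i \<noteq> axis j (\<nu> $ j) $ i" unfolding vec_eq_iff by blast
      then have "i \<noteq> j" "\<nu> $ i \<noteq> 0" by (auto simp: axis_def split: if_splits)
      then show ?thesis by (auto simp: monom_val_def axis_def intro!: exI[of _ i])
    qed
    ultimately have "((\<lambda>\<nu>. c \<nu> * monom_val (axis j t) \<nu>) has_sum h (axis j t)) (range (axis j))"
      by (subst has_sum_cong_neutral[where T = UNIV]) auto
    then have "(((\<lambda>\<nu>. c \<nu> * monom_val (axis j t) \<nu>) \<circ> axis j) has_sum h (axis j t)) UNIV"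
      by (subst (asm) has_sum_reindex) (auto simp: inj_on_def axis_eq_axis)
    then have "((\<lambda>m. c (axis j m) * t ^ m) has_sum h (axis j t)) UNIV"
      by (simp add: o_def monom_val_axis)
    then show ?thesis unfolding axis_fps_def by (simp add: has_sum_imp_sums)
  qed
  moreover have "\<forall>\<^sub>F t in nhds 0. t \<in> ball (0::complex) r"
    by (rule eventually_nhds_in_open) (use r in auto)
  ultimately show "\<forall>\<^sub>F t in nhds 0. (\<lambda>m. fps_nth (axis_fps c j) m * t ^ m) sums h (axis j t)"
    by (auto elim: eventually_mono)
qed

lemma axis_exponent_eq_subdegree:
  assumes "axis_fps (taylor_coeff h) j \<noteq> 0"
  shows "axis_exponent h j = subdegree (axis_fps (taylor_coeff h) j)"
proof -
  have "\<exists>b. taylor_coeff h (axis j b) \<noteq> 0" using assms by (auto simp: axis_fps_def fps_eq_iff)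
  from axis_exponent_eq_Least[OF this] show ?thesis
    using assms by (simp add: subdegree_def) (simp add: axis_fps_def)
qed

lemma subdegree_prod_fps:
  fixes F :: "'a \<Rightarrow> complex fps"
  assumes "finite S" "\<And>\<alpha>. \<alpha> \<in> S \<Longrightarrow> F \<alpha> \<noteq> 0"
  shows "(\<Prod>\<alpha>\<in>S. F \<alpha>) \<noteq> 0 \<and> subdegree (\<Prod>\<alpha>\<in>S. F \<alpha>) = (\<Sum>\<alpha>\<in>S. subdegree (F \<alpha>))"
  using assms by (induction S) auto

text \<open>An axis exponent is the order of vanishing along the axis, that is, the subdegree of a formal power
  series in one variable over a field, and such orders add up under multiplication.\<close>

lemma axis_exponent_of_product:
  fixes g :: "'a \<Rightarrow> complex^'n \<Rightarrow> complex"
  assumes S: "finite S" and g: "\<And>\<alpha>. \<alpha> \<in> S \<Longrightarrow> power_series_on r (g \<alpha>) (taylor_coeff (g \<alpha>))"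
    and conv: "\<And>\<alpha>. \<alpha> \<in> S \<Longrightarrow> convenient (g \<alpha>)"
    and f_def: "f = (\<lambda>z. \<Prod>\<alpha>\<in>S. g \<alpha> z)" and f: "power_series_on r f (taylor_coeff f)"
  shows "axis_fps (taylor_coeff f) j \<noteq> 0" and "axis_exponent f j = (\<Sum>\<alpha>\<in>S. axis_exponent (g \<alpha>) j)"
proof -
  let ?F = "\<lambda>\<alpha>. axis_fps (taylor_coeff (g \<alpha>)) j"
  have ne: "?F \<alpha> \<noteq> 0" if "\<alpha> \<in> S" for \<alpha>
    using convenient_axis_monomial[OF conv[OF that], of j] by (auto simp: axis_fps_def fps_eq_iff)
  have "(\<lambda>t. \<Prod>\<alpha>\<in>S. g \<alpha> (axis j t)) has_fps_expansion (\<Prod>\<alpha>\<in>S. ?F \<alpha>)"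
    by (rule has_fps_expansion_prod) (rule axis_fps_expansion[OF g])
  then have eq: "axis_fps (taylor_coeff f) j = (\<Prod>\<alpha>\<in>S. ?F \<alpha>)"
    using axis_fps_expansion[OF f, of j] unfolding f_def by (simp add: fps_eq_iff fps_nth_fps_expansion)
  then show "axis_fps (taylor_coeff f) j \<noteq> 0" using subdegree_prod_fps[of S ?F] S ne by simp
  then have "axis_exponent f j = subdegree (\<Prod>\<alpha>\<in>S. ?F \<alpha>)"
    using axis_exponent_eq_subdegree eq by metis
  also have "\<dots> = (\<Sum>\<alpha>\<in>S. subdegree (?F \<alpha>))" using subdegree_prod_fps[of S ?F] S ne by blast
  also have "\<dots> = (\<Sum>\<alpha>\<in>S. axis_exponent (g \<alpha>) j)"
    by (rule sum.cong) (use axis_exponent_eq_subdegree[OF ne] in auto)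
  finally show "axis_exponent f j = (\<Sum>\<alpha>\<in>S. axis_exponent (g \<alpha>) j)" .
qed

lemma fps_expansion_leading_limit:
  fixes \<phi> :: "complex \<Rightarrow> complex"
  assumes F: "\<phi> has_fps_expansion F" and N: "\<And>m. m < N \<Longrightarrow> fps_nth F m = 0"
  shows "((\<lambda>t. \<phi> t / t ^ N) \<longlongrightarrow> fps_nth F N) (at 0)"
proof (cases "F = 0")
  case True
  then have "\<forall>\<^sub>F t in nhds 0. \<phi> t = 0" using F by (auto simp: has_fps_expansion_def elim: eventually_mono)
  then have "\<forall>\<^sub>F t in at 0. \<phi> t / t ^ N = 0"
    unfolding eventually_at_filter by (rule eventually_mono) auto
  then show ?thesis using True by (simp add: tendsto_eventually)
next
  case False
  then have "N \<le> subdegree F" using N by (intro subdegree_geI) auto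
  from has_fps_expansion_shift[OF F this refl]
  have "continuous (at 0) (\<lambda>t. if t = 0 then fps_nth F N else \<phi> t / t ^ N)"
    by (rule has_fps_expansion_imp_continuous)
  then have "((\<lambda>t. if t = 0 then fps_nth F N else \<phi> t / t ^ N) \<longlongrightarrow> fps_nth F N) (at 0)"
    by (simp add: continuous_within)
  then show ?thesis
    by (rule Lim_transform_eventually) (auto simp: eventually_at_filter)
qed

text \<open>Along the \<open>j\<close>-th axis \<open>h\<close> has order exactly \<open>B\<close>. The \<open>j\<close>-th derivative has order \<open>B - 1\<close>, and
  the \<open>i\<close>-th derivative sees just the monomials \<open>z\<^sub>j\<^sup>m z\<^sub>i\<close>, hence has order at least \<open>B - 1\<close> too. An
  admissible \<open>\<theta>\<close> thus satisfies \<open>t\<^sup>B\<^sup>\<theta> \<le> const * t\<^sup>B\<^sup>-\<^sup>1\<close> for small \<open>t > 0\<close>.\<close>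

lemma lojasiewicz_admissible_lower_bound:
  fixes h :: "complex^'n \<Rightarrow> complex"
  assumes h: "power_series_on r h c" and B: "1 \<le> B"
    and low: "\<And>m. m < B \<Longrightarrow> c (axis j m) = 0" and lead: "c (axis j B) \<noteq> 0"
    and mixed: "\<And>i m. i \<noteq> j \<Longrightarrow> m + 1 < B \<Longrightarrow> c (axis j m + axis i 1) = 0"
    and adm: "lojasiewicz_admissible h \<theta>"
  shows "1 - 1 / real B \<le> \<theta>"
proof (rule ccontr)
  assume "\<not> ?thesis"
  then have less: "0 < real B - 1 - real B * \<theta>" using B by (simp add: field_simps)
  obtain C U where C: "0 < C" and U: "open U" "0 \<in> U"
    and ineq: "\<And>z. z \<in> U \<Longrightarrow> C * (if \<theta> = 0 then 1 else norm (h z) powr \<theta>) \<le> norm (cgrad h z)"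
    using adm unfolding lojasiewicz_admissible_def by blast
  let ?p = "\<lambda>t. axis j (complex_of_real t) :: complex^'n"
  have of_real_0: "((\<lambda>t. complex_of_real t) \<longlongrightarrow> 0) (at_right 0)"
    using tendsto_of_real[OF tendsto_ident_at, of 0 "{0<..}"] by simp
  have t_pos: "\<forall>\<^sub>F t in at_right (0::real). 0 < t" by (rule eventually_at_right_less)
  have of_real_lim: "filterlim (\<lambda>t. complex_of_real t) (at 0) (at_right 0)"
    unfolding filterlim_at using of_real_0 t_pos by (auto elim: eventually_mono)
  have h_lim: "((\<lambda>t. h (?p t) / of_real t ^ B) \<longlongrightarrow> c (axis j B)) (at_right 0)"
    using filterlim_compose[OF fps_expansion_leading_limit[OF axis_fps_expansion[OF h]] of_real_lim, of B j] low
    by (simp add: axis_fps_def)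
  have "\<exists>l. ((\<lambda>t. cgrad h (?p t) $ i / of_real t ^ (B - 1)) \<longlongrightarrow> l) (at_right 0)" for i
  proof -
    let ?g = "\<lambda>\<nu>. of_nat (\<nu> $ i + 1) * c (\<nu> + axis i 1)"
    have "?g (axis j m) = 0" if m: "m < B - 1" for m
    proof (cases "i = j")
      case True
      have "axis j m + axis j 1 = (axis j (m + 1) :: nat^'n)" by (simp add: vec_eq_iff axis_def)
      then show ?thesis using low[of "m + 1"] m True by simp
    next
      case False
      then show ?thesis using mixed[of i m] m by simp
    qed
    then have "((\<lambda>t. cgrad h (axis j t) $ i / t ^ (B - 1)) \<longlongrightarrow> fps_nth (axis_fps ?g j) (B - 1)) (at 0)"
      by (intro fps_expansion_leading_limit axis_fps_expansion[OF power_series_gradient[OF h]])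
         (simp add: axis_fps_def)
    from filterlim_compose[OF this of_real_lim] show ?thesis by blast
  qed
  then obtain l where l: "\<And>i. ((\<lambda>t. cgrad h (?p t) $ i / of_real t ^ (B - 1)) \<longlongrightarrow> l i) (at_right 0)"
    by metis
  let ?lhs = "\<lambda>t. C * norm (h (?p t) / of_real t ^ B) powr \<theta>"
  let ?rhs = "\<lambda>t. (\<Sum>i\<in>UNIV. norm (cgrad h (?p t) $ i / of_real t ^ (B - 1))) * t powr (real B - 1 - real B * \<theta>)"
  have p0: "(?p \<longlongrightarrow> 0) (at_right 0)"
  proof (rule vec_tendstoI)
    fix i
    show "((\<lambda>t. ?p t $ i) \<longlongrightarrow> 0 $ i) (at_right 0)"
      by (cases "i = j") (simp_all add: axis_def of_real_0)
  qed
  have "\<forall>\<^sub>F t in at_right 0. ?p t \<in> U" by (rule topological_tendstoD[OF p0 U])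
  moreover have "\<forall>\<^sub>F t in at_right 0. h (?p t) / of_real t ^ B \<noteq> 0"
    by (rule tendsto_imp_eventually_ne[OF h_lim lead])
  moreover note t_pos
  ultimately have ev: "\<forall>\<^sub>F t in at_right 0. ?lhs t \<le> ?rhs t"
  proof eventually_elim
    case (elim t)
    let ?y = "norm (h (?p t) / of_real t ^ B)"
    have y: "0 < ?y" using elim by simp
    have "norm (h (?p t)) = ?y * t ^ B" using elim by (simp add: norm_divide norm_power)
    also have "\<dots> = ?y * t powr real B" using elim by (simp add: powr_realpow)
    finally have nh: "norm (h (?p t)) = ?y * t powr real B" .
    have "norm (h (?p t)) powr \<theta> = ?y powr \<theta> * t powr (real B * \<theta>)"
      by (simp only: nh powr_mult powr_powr)
    moreover have "norm (h (?p t)) powr \<theta> = (if \<theta> = 0 then 1 else norm (h (?p t)) powr \<theta>)"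
      using elim by simp
    ultimately have "?lhs t * t powr (real B * \<theta>) = C * (if \<theta> = 0 then 1 else norm (h (?p t)) powr \<theta>)"
      by (simp only: mult.assoc)
    also have "\<dots> \<le> norm (cgrad h (?p t))" by (rule ineq[OF elim(1)])
    also have "\<dots> \<le> (\<Sum>i\<in>UNIV. norm (cgrad h (?p t) $ i))"
      unfolding norm_vec_def by (rule L2_set_le_sum) auto
    also have "\<dots> = (\<Sum>i\<in>UNIV. norm (cgrad h (?p t) $ i / of_real t ^ (B - 1))) * t ^ (B - 1)"
      using elim by (simp add: norm_divide norm_power sum_distrib_right)
    also have "t ^ (B - 1) = t powr (real B - 1 - real B * \<theta>) * t powr (real B * \<theta>)"
    proof -
      have "t ^ (B - 1) = t powr real (B - 1)" by (rule powr_realpow[symmetric]) (rule elim(3))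
      also have "real (B - 1) = (real B - 1 - real B * \<theta>) + real B * \<theta>" using B by (simp add: of_nat_diff)
      finally show ?thesis by (simp only: powr_add)
    qed
    finally have "?lhs t * t powr (real B * \<theta>) \<le> ?rhs t * t powr (real B * \<theta>)" by (simp only: mult.assoc)
    then show ?case by (rule mult_right_le_imp_le) (use elim(3) in simp)
  qed
  have lim_l: "(?lhs \<longlongrightarrow> C * norm (c (axis j B)) powr \<theta>) (at_right 0)"
    by (intro tendsto_mult tendsto_const tendsto_powr tendsto_norm h_lim) (use lead in simp)
  have lim_r: "(?rhs \<longlongrightarrow> (\<Sum>i\<in>UNIV. norm (l i)) * 0) (at_right 0)"
  proof (intro tendsto_mult tendsto_sum tendsto_norm l)
    show "((\<lambda>t. t powr (real B - 1 - real B * \<theta>)) \<longlongrightarrow> 0) (at_right 0)"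
      by (rule tendsto_zero_powrI[OF tendsto_ident_at tendsto_const eventually_mono[OF t_pos] less]) simp
  qed
  have "C * norm (c (axis j B)) powr \<theta> \<le> (\<Sum>i\<in>UNIV. norm (l i)) * 0"
    by (rule tendsto_le[OF trivial_limit_at_right_real lim_r lim_l ev])
  moreover have "0 < C * norm (c (axis j B)) powr \<theta>" using C lead by simp
  ultimately show False by simp
qed

text \<open>An exponent outside the box exceeds some axis exponent and so lies strictly above a pure power of
  the box; convenience thereby replaces Dickson's lemma in finding a finite dominating set.\<close>

lemma convenient_box_dominates:
  fixes h :: "complex^'n \<Rightarrow> complex"
  assumes conv: "convenient h"
  defines "A \<equiv> {\<nu>. taylor_coeff h \<nu> \<noteq> 0 \<and> (\<forall>j. \<nu> $ j \<le> axis_exponent h j)}"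
  shows "axis j (axis_exponent h j) \<in> A" and "dominates A (taylor_coeff h)"
proof -
  have ax: "axis j (axis_exponent h j) \<in> A" for j
    using convenient_axis_monomial[OF conv] by (simp add: A_def axis_def)
  then show "axis j (axis_exponent h j) \<in> A" .
  have "A \<subseteq> {\<nu>. \<nu> \<le> (\<chi> j. axis_exponent h j)}" by (auto simp: A_def less_eq_vec_def)
  then have "finite A" by (rule finite_subset) (rule finite_multiindices_le)
  moreover have "\<exists>\<mu>\<in>A. \<exists>j \<eta>. \<nu> = \<mu> + axis j 1 + \<eta>" if \<nu>: "taylor_coeff h \<nu> \<noteq> 0" "\<nu> \<notin> A" for \<nu>
  proof -
    obtain j where "axis_exponent h j < \<nu> $ j" using \<nu> by (auto simp: A_def not_le)
    then have "\<nu> = axis j (axis_exponent h j) + axis j 1 + (\<nu> - axis j (axis_exponent h j + 1))"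
      by (simp add: vec_eq_iff axis_def)
    then show ?thesis by (intro bexI[OF _ ax] exI)
  qed
  ultimately show "dominates A (taylor_coeff h)" by (simp add: dominates_def)
qed

theorem theorem30:
  fixes k :: nat
    and fs :: "nat \<Rightarrow> complex^'n \<Rightarrow> complex"
    and f :: "complex^'n \<Rightarrow> complex"
    and B :: nat
  assumes "1 \<le> k"
    and "defining_family k fs"
    and "\<And>\<alpha>. \<alpha> \<in> {1..k} \<Longrightarrow> fs \<alpha> 0 = 0"
    and "f = (\<lambda>z. \<Prod>\<alpha>\<in>{1..k}. fs \<alpha> z)"
    and "B = Max (range (\<lambda>j. \<Sum>\<alpha>\<in>{1..k}. axis_exponent (fs \<alpha>) j))"
  shows "lojasiewicz_exponent f \<le> ereal (1 - 1 / real B) \<and>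
         ((\<exists>j. lojasiewicz_monomial f j \<and> \<not> exceptional_monomial f j) \<longrightarrow>
            lojasiewicz_exponent f = ereal (1 - 1 / real B))"
proof -
  let ?S = "{1..k}"
  define A where "A \<alpha> = {\<nu>. taylor_coeff (fs \<alpha>) \<nu> \<noteq> 0 \<and> (\<forall>j. \<nu> $ j \<le> axis_exponent (fs \<alpha>) j)}" for \<alpha>
  have fam: "analytic_at_0 (fs \<alpha>)" "convenient (fs \<alpha>)" if "\<alpha> \<in> ?S" for \<alpha>
    using assms(2) that by (auto simp: defining_family_def)
  have "\<exists>r. power_series_on r (fs \<alpha>) (taylor_coeff (fs \<alpha>))" if "\<alpha> \<in> ?S" for \<alpha>
    using analytic_at_0_power_series[OF fam(1)[OF that]] by blast
  then obtain R where R: "\<And>\<alpha>. \<alpha> \<in> ?S \<Longrightarrow> power_series_on (R \<alpha>) (fs \<alpha>) (taylor_coeff (fs \<alpha>))" by metis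
  define r where "r = Min (R ` ?S)"
  have "0 < r" unfolding r_def using R assms(1) by (subst Min_gr_iff) (auto simp: power_series_on_def)
  have series: "power_series_on r (fs \<alpha>) (taylor_coeff (fs \<alpha>))" if "\<alpha> \<in> ?S" for \<alpha>
    by (rule power_series_on_mono[OF R[OF that] \<open>0 < r\<close>]) (use that in \<open>simp add: r_def\<close>)
  have axisA: "axis j (axis_exponent (fs \<alpha>) j) \<in> A \<alpha>" if "\<alpha> \<in> ?S" for \<alpha> j
    unfolding A_def by (rule convenient_box_dominates(1)[OF fam(2)[OF that]])
  interpret newton_family ?S fs A r
  proof
    show "dominates (A \<alpha>) (taylor_coeff (fs \<alpha>))" if "\<alpha> \<in> ?S" for \<alpha>
      unfolding A_def by (rule convenient_box_dominates(2)[OF fam(2)[OF that]])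
    show "A \<alpha> \<noteq> {}" if "\<alpha> \<in> ?S" for \<alpha> using axisA[OF that] by blast
    show "nondegenerate_complete_intersection fs I" if "I \<subseteq> ?S" for I
      using assms(2) that by (simp add: defining_family_def)
  qed (use assms(1,3) series in \<open>auto simp: A_def\<close>)
  have leB: "(\<Sum>\<alpha>\<in>?S. axis_exponent (fs \<alpha>) j) \<le> B" for j unfolding assms(5) by (rule Max_ge) auto
  have "card ?S \<le> (\<Sum>\<alpha>\<in>?S. axis_exponent (fs \<alpha>) undefined)" by (rule card_le_axis_exponent_sum) (rule axisA)
  then have "k \<le> B" using leB[of undefined] by simp
  then have B1: "1 \<le> B" using assms(1) by simp
  have "\<exists>K>0. \<forall>\<^sub>F z in nhds 0. K * norm (f z) ^ (B - 1) \<le> norm (cgrad f z) ^ B"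
    unfolding assms(4) by (rule gradient_inequality[OF axisA leB])
  then obtain K where K: "0 < K" "\<forall>\<^sub>F z in nhds 0. K * norm (f z) ^ (B - 1) \<le> norm (cgrad f z) ^ B"
    by blast
  have adm: "lojasiewicz_admissible f (1 - 1 / real B)"
    by (rule lojasiewicz_admissible_of_power_inequality[OF K(1) B1 K(2)])
  then have upper: "lojasiewicz_exponent f \<le> ereal (1 - 1 / real B)"
    unfolding lojasiewicz_exponent_def by (intro INF_lower) simp
  have "\<exists>c. power_series_on r f c"
    unfolding assms(4) by (rule power_series_on_prod[OF finS r_pos]) (use series in blast)
  then obtain cf where cf: "power_series_on r f cf" ..
  then have "taylor_coeff f = cf" by (intro taylor_coeff_eq) (auto simp: has_power_series_0_iff)
  with cf have f_series: "power_series_on r f (taylor_coeff f)" by simp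
  have ne: "axis_fps (taylor_coeff f) j \<noteq> 0" for j
    by (rule axis_exponent_of_product(1)[OF finS series fam(2) assms(4) f_series])
  have axis_f: "axis_exponent f j = (\<Sum>\<alpha>\<in>?S. axis_exponent (fs \<alpha>) j)" for j
    by (rule axis_exponent_of_product(2)[OF finS series fam(2) assms(4) f_series])
  have "lojasiewicz_exponent f = ereal (1 - 1 / real B)"
    if j: "lojasiewicz_monomial f j" "\<not> exceptional_monomial f j" for j
  proof (rule antisym[OF upper])
    have max: "max_axis_exponent f = B"
      unfolding max_axis_exponent_def assms(5) axis_f ..
    have sub: "subdegree (axis_fps (taylor_coeff f) j) = B"
      using j(1) axis_exponent_eq_subdegree[OF ne] max by (simp add: lojasiewicz_monomial_def)
    have "1 - 1 / real B \<le> \<theta>" if adm: "lojasiewicz_admissible f \<theta>" for \<theta>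
    proof (rule lojasiewicz_admissible_lower_bound[OF f_series B1 _ _ _ adm])
      show "taylor_coeff f (axis j m) = 0" if "m < B" for m
        using nth_less_subdegree_zero[of m "axis_fps (taylor_coeff f) j"] that sub by (simp add: axis_fps_def)
      show "taylor_coeff f (axis j B) \<noteq> 0"
        using nth_subdegree_nonzero[OF ne[of j]] unfolding sub by (simp add: axis_fps_def)
      show "taylor_coeff f (axis j m + axis i 1) = 0" if "i \<noteq> j" "m + 1 < B" for i m
        using j that max by (auto simp: exceptional_monomial_def)
    qed
    then show "ereal (1 - 1 / real B) \<le> lojasiewicz_exponent f"
      unfolding lojasiewicz_exponent_def by (intro INF_greatest) simp
  qed
  with upper show ?thesis by blast
qed

end
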